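(* Let $G$ be an oligomorphic group. Then every irreducible unitary representation of $G$ is of the form $\mathrm{Ind}_{C(V)}^G(\sigma)$, where $V \leq G$ is an open subgroup, $C(V)$ is the commensurator of $V$ in $G$, $V \unlhd C(V)$, the group $C(V)/V$ is finite, and $\sigma$ is an irreducible representation of the finite group $C(V)/V$ (viewed as a representation of $C(V)$). Moreover, every unitary representation of $G$ is a (Hilbert space direct) sum of irreducible representations.
   Context: For a countable (finite or infinite) set $\mathbf{X}$, the group of all permutations of $\mathbf{X}$ carries the topology of pointwise convergence with $\mathbf{X}$ discrete; a permutation group on $\mathbf{X}$ is a topological subgroup $G$ of it. It is called oligomorphic if for each $n$ the diagonal action of $G$ on $\mathbf{X}^n$ has only finitely many orbits. A topological group is oligomorphic if it is isomorphic, as a topological group, to an oligomorphic permutation group. Unitary representations are on complex Hilbert spaces and are strongly continuous (i.e. $g\mapsto \pi(g)\xi$ is continuous for every vector $\xi$); $\mathcal{H}(\pi)$ denotes the Hilbert space of $\pi$. Two subgroups are commensurate if their intersection has finite index in both. The commensurator of $V \le G$ is $C(V) = \{g \in G : V \text{ and } gVg^{-1} \text{ are commensurate}\}$, a subgroup of $G$ containing $V$. If $H$ is an open subgroup of $G$ and $\sigma$ a representation of $H$, the induced representation $\mathrm{Ind}_H^G(\sigma)$ acts on the Hilbert space of all functions $f\colon G \to \mathcal{H}(\sigma)$ satisfying $f(gh) = \sigma(h^{-1})f(g)$ for all $g \in G$, $h \in H$, and $\|f\|^2 = \sum_{g \in T}\|f(g)\|^2 < \infty$, where $T$ is a complete system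 of left coset representatives of $H$ in $G$; the action is $(\mathrm{Ind}_H^G(\sigma)(g)f)(x) = f(g^{-1}x)$. *)

theory Defs
  imports "HOL-Analysis.Analysis" "HOL-Algebra.Bij" "HOL-Algebra.Group_Action"
begin

section \<open>Complex Hilbert spaces\<close>

text \<open>
  The library has real inner product spaces only. A complex Hilbert space is a complete real inner
  product space with a compatible complex scalar multiplication and a complex inner product
  (linear in the first argument) whose real part is the given real one; thus norm, topology and
  completeness are those of the library. Concrete Hilbert spaces are closed complex subspaces
  of such a type.
\<close>

class complex_hilbert_space = real_inner + complete_space +
  fixes scaleC :: "complex \<Rightarrow> 'a \<Rightarrow> 'a"  (infixr "*\<^sub>C" 75)
    and cinner :: "'a \<Rightarrow> 'a \<Rightarrow> complex"
  assumes scaleC_add_right: "a *\<^sub>C (x + y) = a *\<^sub>C x + a *\<^sub>C y"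
    and scaleC_add_left: "(a + b) *\<^sub>C x = a *\<^sub>C x + b *\<^sub>C x"
    and scaleC_scaleC: "a *\<^sub>C b *\<^sub>C x = (a * b) *\<^sub>C x"
    and scaleC_of_real: "complex_of_real r *\<^sub>C x = r *\<^sub>R x"
    and cinner_commute: "cinner x y = cnj (cinner y x)"
    and cinner_add_left: "cinner (x + y) z = cinner x z + cinner y z"
    and cinner_scaleC_left: "cinner (a *\<^sub>C x) y = a * cinner x y"
    and Re_cinner: "Re (cinner x y) = x \<bullet> y"

instantiation complex :: complex_hilbert_space
begin

definition scaleC_complex :: "complex \<Rightarrow> complex \<Rightarrow> complex"
  where "scaleC_complex a x = a * x"

definition cinner_complex :: "complex \<Rightarrow> complex \<Rightarrow> complex"
  where "cinner_complex x y = x * cnj y"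

instance
  by standard
    (auto simp: scaleC_complex_def cinner_complex_def algebra_simps scaleR_conv_of_real
        inner_complex_def)

end

definition closed_csubspace :: "'h::complex_hilbert_space set \<Rightarrow> bool"
  where "closed_csubspace H \<longleftrightarrow>
    closed H \<and> 0 \<in> H \<and> (\<forall>x\<in>H. \<forall>y\<in>H. x + y \<in> H) \<and> (\<forall>c. \<forall>x\<in>H. c *\<^sub>C x \<in> H)"


section \<open>Topological groups and oligomorphic groups\<close>

definition topological_group :: "('g, 'z) monoid_scheme \<Rightarrow> 'g topology \<Rightarrow> bool"
  where "topological_group G T \<longleftrightarrow>
    group G \<and> topspace T = carrier G \<and>
    continuous_map (prod_topology T T) T (\<lambda>(x, y). x \<otimes>\<^bsub>G\<^esub> y) \<and>
    continuous_map T T (\<lambda>x. inv\<^bsub>G\<^esub> x)"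

definition permutation_group_topology :: "'x set \<Rightarrow> ('x \<Rightarrow> 'x) set \<Rightarrow> ('x \<Rightarrow> 'x) topology"
  where "permutation_group_topology X P =
    subtopology (product_topology (\<lambda>_. discrete_topology X) X) P"

text \<open>Elements of \<open>X\<^sup>n\<close> are lists of length \<open>n\<close>, on which a permutation acts diagonally by \<^const>\<open>map\<close>.\<close>

definition oligomorphic_permutation_group :: "'x set \<Rightarrow> ('x \<Rightarrow> 'x) set \<Rightarrow> bool"
  where "oligomorphic_permutation_group X P \<longleftrightarrow>
    countable X \<and> subgroup P (BijGroup X) \<and>
    (\<forall>n. finite (orbits (BijGroup X\<lparr>carrier := P\<rparr>) {xs. set xs \<subseteq> X \<and> length xs = n} map))"

text \<open>
  The countable set may be taken to be a set of natural numbers, since transport along a bijection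
  of the underlying sets is an isomorphism of topological groups preserving oligomorphy.
\<close>

definition oligomorphic_group :: "('g, 'z) monoid_scheme \<Rightarrow> 'g topology \<Rightarrow> bool"
  where "oligomorphic_group G T \<longleftrightarrow>
    topological_group G T \<and>
    (\<exists>(X :: nat set) P \<phi>. oligomorphic_permutation_group X P \<and>
      \<phi> \<in> iso G (BijGroup X\<lparr>carrier := P\<rparr>) \<and>
      homeomorphic_map T (permutation_group_topology X P) \<phi>)"


section \<open>Commensurators\<close>

definition commensurate :: "('g, 'z) monoid_scheme \<Rightarrow> 'g set \<Rightarrow> 'g set \<Rightarrow> bool"
  where "commensurate G A B \<longleftrightarrow>
    finite (rcosets\<^bsub>G\<lparr>carrier := A\<rparr>\<^esub> (A \<inter> B)) \<and> finite (rcosets\<^bsub>G\<lparr>carrier := B\<rparr>\<^esub> (A \<inter> B))"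

definition commensurator :: "('g, 'z) monoid_scheme \<Rightarrow> 'g set \<Rightarrow> 'g set"
  where "commensurator G V =
    {g \<in> carrier G. commensurate G V (g <#\<^bsub>G\<^esub> V #>\<^bsub>G\<^esub> inv\<^bsub>G\<^esub> g)}"


section \<open>Unitary representations\<close>

text \<open>
  Unitarity is stated as invariance of the inner product; surjectivity of each \<open>\<pi> g\<close> on \<open>H\<close> follows
  from the group action laws.
\<close>

definition unitary_rep ::
    "('g, 'z) monoid_scheme \<Rightarrow> 'g topology \<Rightarrow> 'h::complex_hilbert_space set \<Rightarrow>
     ('g \<Rightarrow> 'h \<Rightarrow> 'h) \<Rightarrow> bool"
  where "unitary_rep G T H \<pi> \<longleftrightarrow>
    closed_csubspace H \<and>
    (\<forall>g\<in>carrier G. \<forall>x\<in>H. \<pi> g x \<in> H) \<and>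
    (\<forall>g\<in>carrier G. \<forall>x\<in>H. \<forall>y\<in>H. \<pi> g (x + y) = \<pi> g x + \<pi> g y) \<and>
    (\<forall>g\<in>carrier G. \<forall>c. \<forall>x\<in>H. \<pi> g (c *\<^sub>C x) = c *\<^sub>C \<pi> g x) \<and>
    (\<forall>g\<in>carrier G. \<forall>x\<in>H. \<forall>y\<in>H. cinner (\<pi> g x) (\<pi> g y) = cinner x y) \<and>
    (\<forall>x\<in>H. \<pi> \<one>\<^bsub>G\<^esub> x = x) \<and>
    (\<forall>g\<in>carrier G. \<forall>h\<in>carrier G. \<forall>x\<in>H. \<pi> (g \<otimes>\<^bsub>G\<^esub> h) x = \<pi> g (\<pi> h x)) \<and>
    (\<forall>x\<in>H. continuous_map T euclidean (\<lambda>g. \<pi> g x))"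

definition irreducible_unitary_rep ::
    "('g, 'z) monoid_scheme \<Rightarrow> 'g topology \<Rightarrow> 'h::complex_hilbert_space set \<Rightarrow>
     ('g \<Rightarrow> 'h \<Rightarrow> 'h) \<Rightarrow> bool"
  where "irreducible_unitary_rep G T H \<pi> \<longleftrightarrow>
    unitary_rep G T H \<pi> \<and> H \<noteq> {0} \<and>
    (\<forall>M. closed_csubspace M \<and> M \<subseteq> H \<and> (\<forall>g\<in>carrier G. \<pi> g ` M \<subseteq> M) \<longrightarrow> M = {0} \<or> M = H)"

text \<open>
  Internal Hilbert space direct sum. The real \<^const>\<open>span\<close> of a union of complex subspaces is
  already their complex span.
\<close>

definition direct_sum_of_irreducibles ::
    "('g, 'z) monoid_scheme \<Rightarrow> 'g topology \<Rightarrow> 'h::complex_hilbert_space set \<Rightarrow>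
     ('g \<Rightarrow> 'h \<Rightarrow> 'h) \<Rightarrow> bool"
  where "direct_sum_of_irreducibles G T H \<pi> \<longleftrightarrow>
    (\<exists>\<M>. (\<forall>M\<in>\<M>. M \<subseteq> H \<and> irreducible_unitary_rep G T M \<pi>) \<and>
      (\<forall>M\<in>\<M>. \<forall>N\<in>\<M>. M \<noteq> N \<longrightarrow> (\<forall>x\<in>M. \<forall>y\<in>N. cinner x y = 0)) \<and>
      closure (span (\<Union>\<M>)) = H)"


section \<open>Induced representations\<close>

definition left_transversal :: "('g, 'z) monoid_scheme \<Rightarrow> 'g set \<Rightarrow> 'g set \<Rightarrow> bool"
  where "left_transversal G C R \<longleftrightarrow>
    R \<subseteq> carrier G \<and> (\<forall>g\<in>carrier G. \<exists>!t. t \<in> R \<and> g \<in> t <#\<^bsub>G\<^esub> C)"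

lemma (in group) left_transversal_exists:
  assumes C: "subgroup C G"
  shows "\<exists>R. left_transversal G C R"
proof -
  define r where "r g = (SOME t. t \<in> g <# C)" for g
  have self: "g \<in> g <# C" if "g \<in> carrier G" for g
  proof -
    have "g = g \<otimes> \<one>" using that by simp
    then show ?thesis using subgroup.one_closed[OF C] unfolding l_coset_def by blast
  qed
  have r: "r g \<in> g <# C" if "g \<in> carrier G" for g
    unfolding r_def by (rule someI[where P = "\<lambda>t. t \<in> g <# C", OF self[OF that]])
  have r_carr: "r g \<in> carrier G" if "g \<in> carrier G" for g
    by (rule l_coset_carrier[OF r[OF that] that C])
  have coset: "r g <# C = g <# C" if "g \<in> carrier G" for g
    by (rule l_repr_independence[OF r[OF that] that C, symmetric])
  have "\<exists>!t. t \<in> r ` carrier G \<and> g \<in> t <# C" if g: "g \<in> carrier G" for g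
  proof (rule ex1I[of _ "r g"], intro conjI)
    show "r g \<in> r ` carrier G" using g by (rule imageI)
    show "g \<in> r g <# C" unfolding coset[OF g] by (rule self[OF g])
    fix t assume t: "t \<in> r ` carrier G \<and> g \<in> t <# C"
    then obtain h where h: "h \<in> carrier G" "t = r h" by blast
    have "g \<in> h <# C" using t unfolding h(2) coset[OF h(1)] by (rule conjunct2)
    then have "h <# C = g <# C" by (rule l_repr_independence[OF _ h(1) C])
    then show "t = r g" unfolding h(2) r_def by (rule arg_cong)
  qed
  then have "left_transversal G C (r ` carrier G)"
    unfolding left_transversal_def using r_carr by (intro conjI ballI image_subsetI)
  then show ?thesis by (rule exI)
qed

text \<open>
  The Hilbert space of \<open>Ind\<^sub>C\<^sup>G(\<sigma>)\<close>, where \<open>\<sigma>\<close> is a representation of \<open>C\<close> on \<open>K\<close> and \<open>R\<close> is a complete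
  system of left coset representatives; the space and its norm do not depend on the choice
  of \<open>R\<close>. Functions on the group are represented extensionally.
\<close>

definition induced_space ::
    "('g, 'z) monoid_scheme \<Rightarrow> 'g set \<Rightarrow> 'h::complex_hilbert_space set \<Rightarrow> ('g \<Rightarrow> 'h \<Rightarrow> 'h) \<Rightarrow>
     'g set \<Rightarrow> ('g \<Rightarrow> 'h) set"
  where "induced_space G C K \<sigma> R =
    {f \<in> carrier G \<rightarrow>\<^sub>E K.
      (\<forall>g\<in>carrier G. \<forall>h\<in>C. f (g \<otimes>\<^bsub>G\<^esub> h) = \<sigma> (inv\<^bsub>G\<^esub> h) (f g)) \<and>
      (\<lambda>t. (norm (f t))\<^sup>2) summable_on R}"

definition induced_norm :: "'g set \<Rightarrow> ('g \<Rightarrow> 'h::complex_hilbert_space) \<Rightarrow> real"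
  where "induced_norm R f = sqrt (\<Sum>\<^sub>\<infinity>t\<in>R. (norm (f t))\<^sup>2)"

definition induced_action :: "('g, 'z) monoid_scheme \<Rightarrow> 'g \<Rightarrow> ('g \<Rightarrow> 'h) \<Rightarrow> 'g \<Rightarrow> 'h"
  where "induced_action G g f = (\<lambda>x\<in>carrier G. f (inv\<^bsub>G\<^esub> g \<otimes>\<^bsub>G\<^esub> x))"

text \<open>
  Unitary equivalence of \<open>\<pi>\<close> with the induced representation: a linear, isometric, intertwining
  bijection between the two Hilbert spaces.
\<close>

definition equivalent_to_induced ::
    "('g, 'z) monoid_scheme \<Rightarrow> 'h::complex_hilbert_space set \<Rightarrow> ('g \<Rightarrow> 'h \<Rightarrow> 'h) \<Rightarrow>
     'g set \<Rightarrow> 'k::complex_hilbert_space set \<Rightarrow> ('g \<Rightarrow> 'k \<Rightarrow> 'k) \<Rightarrow> 'g set \<Rightarrow> bool"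
  where "equivalent_to_induced G H \<pi> C K \<sigma> R \<longleftrightarrow>
    (\<exists>U. bij_betw U H (induced_space G C K \<sigma> R) \<and>
      (\<forall>x\<in>H. \<forall>y\<in>H. U (x + y) = (\<lambda>g\<in>carrier G. U x g + U y g)) \<and>
      (\<forall>c. \<forall>x\<in>H. U (c *\<^sub>C x) = (\<lambda>g\<in>carrier G. c *\<^sub>C U x g)) \<and>
      (\<forall>x\<in>H. induced_norm R (U x) = norm x) \<and>
      (\<forall>g\<in>carrier G. \<forall>x\<in>H. U (\<pi> g x) = induced_action G g (U x)))"

end

theory Submission
  imports Defs "HOL-Library.Ramsey"
begin

text \<open>
  The proof uses two consequences of oligomorphy: the open subgroups form a neighbourhood base of
  the identity, and every open subgroup \<open>V\<close> has only finitely many double cosets \<open>V g V\<close>. The second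
  one makes representations rigid: if \<open>\<xi>\<close> is fixed by \<open>V\<close>, then the coefficient \<open>\<langle>g \<xi>, \<xi>\<rangle>\<close> depends only
  on the double coset of \<open>g\<close>, hence takes finitely many values. Nonzero vectors fixed by an open
  subgroup exist because, for a small open subgroup \<open>V\<close>, the closed convex hull of \<open>V x\<close> stays away
  from \<open>0\<close> and its point of least norm is fixed by \<open>V\<close> (\<open>ex_fixed_vector\<close>).

  For complete reducibility, let \<open>Z\<close> be the closed subspace generated by the orbit of such a vector \<open>\<xi>\<close>.
  A \<open>V\<close>-fixed vector \<open>z \<in> Z\<close> is determined by the numbers \<open>\<langle>z, f \<xi>\<rangle>\<close>, where \<open>f\<close> runs through
  representatives of the double cosets, so the \<open>V\<close>-fixed vectors of \<open>Z\<close> form a finite-dimensional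
  space. Every nonzero invariant subspace of \<open>Z\<close> contains a nonzero \<open>V\<close>-fixed vector, the projection of
  \<open>\<xi>\<close>. Hence a nonzero invariant subspace of \<open>Z\<close> whose space of \<open>V\<close>-fixed vectors has the least possible
  dimension is irreducible (\<open>ex_irreducible_subrep\<close>), and Zorn's lemma decomposes every
  representation (\<open>direct_sum\<close>).

  For the inducing data, let \<open>F\<close> be the finite set of coefficients of \<open>\<xi>\<close>. Among the nonzero
  vectors all of whose coefficients lie in \<open>F\<close> there is one of least norm, \<open>\<eta>\<close>, since the squares of
  their norms lie in \<open>F\<close>. If a translate \<open>x = g \<eta>\<close> has an infinite orbit under the stabilizer of \<open>\<eta>\<close>,
  then \<open>x\<close> is orthogonal to \<open>\<eta>\<close> (\<open>ex_minimal_vector\<close>): by Ramsey's theorem the infinite orbit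
  contains a sequence with constant mutual inner products; it has a weak limit \<open>\<zeta>\<close> of norm strictly
  smaller than that of \<open>\<eta>\<close>, the coefficients of \<open>\<zeta>\<close> lie in the closed set \<open>F\<close> again, and
  \<open>\<langle>\<zeta>, \<eta>\<rangle> = \<langle>x, \<eta>\<rangle>\<close>, so that \<open>\<zeta> = 0\<close> by minimality and therefore \<open>\<langle>x, \<eta>\<rangle> = 0\<close>.

  The translates with a finite orbit form a set \<open>acl \<eta>\<close>, which is finite as there are finitely many
  double cosets. Counting shows that the orbit of \<open>\<eta>\<close> is partitioned into the translates of \<open>acl \<eta>\<close>
  (\<open>acl_eq\<close>), and different blocks of this partition are orthogonal. Let \<open>C\<close> be the setwise and \<open>V\<close>
  the pointwise stabilizer of \<open>acl \<eta>\<close>, and \<open>K\<close> its closed linear span. Then \<open>V\<close> is open and normal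
  in \<open>C\<close> with a finite quotient, which acts on \<open>K\<close>, and \<open>C\<close> is the commensurator of \<open>V\<close>
  (\<open>commensurator_V\<close>): if \<open>g\<close> commensurates \<open>V\<close>, then \<open>g \<eta>\<close> has a finite orbit. If the representation
  is irreducible, it is the Hilbert sum of the mutually orthogonal subspaces \<open>t K\<close>, where \<open>t\<close> runs
  through the left cosets of \<open>C\<close>, which says that it is induced from \<open>K\<close>
  (\<open>equivalent_to_induced_K\<close>); and a proper \<open>C\<close>-invariant subspace of \<open>K\<close> would generate a
  proper invariant subspace of the whole space (\<open>irreducible_K\<close>).
\<close>

section \<open>Geometry of Hilbert spaces\<close>

text \<open>
  The form in which the parallelogram law and computations with inner products deliver Cauchy
  sequences.
\<close>

lemma convergent_if_norm_diff_square_le: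
  fixes x :: "nat \<Rightarrow> 'a::{real_inner,complete_space}"
  assumes le: "\<And>m n. (norm (x m - x n))\<^sup>2 \<le> b m + b n" and b: "b \<longlonglongrightarrow> 0"
  shows "convergent x"
proof -
  have "Cauchy x"
  proof (rule CauchyI)
    fix e :: real assume "0 < e"
    then have "0 < e\<^sup>2 / 2" by simp
    with b have "\<forall>\<^sub>F n in sequentially. b n < e\<^sup>2 / 2"
      by (rule order_tendstoD)
    then obtain N where N: "\<And>n. n \<ge> N \<Longrightarrow> b n < e\<^sup>2 / 2"
      unfolding eventually_sequentially by blast
    have "norm (x m - x n) < e" if "m \<ge> N" "n \<ge> N" for m n
    proof -
      have "(norm (x m - x n))\<^sup>2 < e\<^sup>2"
        using le[of m n] N[OF that(1)] N[OF that(2)] by linarith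
      then show ?thesis using \<open>0 < e\<close> by (rule power2_less_imp_less[OF _ less_imp_le])
    qed
    then show "\<exists>N. \<forall>m\<ge>N. \<forall>n\<ge>N. norm (x m - x n) < e" by blast
  qed
  then show ?thesis by (rule Cauchy_convergent)
qed

lemma norm_diff_square_le_if_midpoint:
  fixes x y :: "'a::real_inner"
  assumes "d \<le> (norm ((1/2) *\<^sub>R x + (1/2) *\<^sub>R y))\<^sup>2"
  shows "(norm (x - y))\<^sup>2 \<le> 2 * ((norm x)\<^sup>2 - d) + 2 * ((norm y)\<^sup>2 - d)"
  using assms by (simp add: power2_norm_eq_inner inner_simps inner_commute)

lemma convex_midpoint:
  assumes "convex S" "x \<in> S" "y \<in> S"
  shows "(1/2) *\<^sub>R x + (1/2) *\<^sub>R y \<in> S"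
  using assms by (intro convexD) auto

text \<open>
  A minimizing sequence converges: by convexity the midpoints of its members have norm at least the
  infimum, and the parallelogram law then bounds the distances.
\<close>

lemma ex_minimal_norm_point:
  fixes S :: "'a::{real_inner,complete_space} set"
  assumes "closed S" "convex S" "S \<noteq> {}"
  shows "\<exists>x\<in>S. \<forall>y\<in>S. norm x \<le> norm y"
proof -
  define d where "d = (INF x\<in>S. (norm x)\<^sup>2)"
  have bdd: "bdd_below ((\<lambda>x. (norm x)\<^sup>2) ` S)" by (rule bdd_belowI[of _ 0]) auto
  have d: "d \<le> (norm x)\<^sup>2" if "x \<in> S" for x
    unfolding d_def by (rule cINF_lower[OF bdd that])
  define \<epsilon> :: "nat \<Rightarrow> real" where "\<epsilon> n = 1 / real (Suc n)" for n
  have "\<epsilon> n > 0" for n by (simp add: \<epsilon>_def)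
  then have "\<exists>x\<in>S. (norm x)\<^sup>2 < d + \<epsilon> n" for n
    using cINF_less_iff[OF assms(3) bdd, of "d + \<epsilon> n"] unfolding d_def by simp
  then obtain x where x: "\<And>n. x n \<in> S" "\<And>n. (norm (x n))\<^sup>2 < d + \<epsilon> n" by metis
  have gap: "(norm (x n))\<^sup>2 - d \<le> \<epsilon> n" for n
    using x(2)[of n] by (simp add: diff_le_eq add.commute less_imp_le)
  have lim0: "\<epsilon> \<longlonglongrightarrow> 0" unfolding \<epsilon>_def by (rule LIMSEQ_Suc[OF lim_1_over_n])
  have "convergent x"
  proof (rule convergent_if_norm_diff_square_le)
    fix m n
    show "(norm (x m - x n))\<^sup>2 \<le> 2 * \<epsilon> m + 2 * \<epsilon> n"
    proof -
      have "d \<le> (norm ((1/2) *\<^sub>R x m + (1/2) *\<^sub>R x n))\<^sup>2"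
        by (rule d, rule convex_midpoint[OF assms(2)]) (rule x(1))+
      then have "(norm (x m - x n))\<^sup>2 \<le> 2 * ((norm (x m))\<^sup>2 - d) + 2 * ((norm (x n))\<^sup>2 - d)"
        by (rule norm_diff_square_le_if_midpoint)
      also have "\<dots> \<le> 2 * \<epsilon> m + 2 * \<epsilon> n"
        by (intro add_mono mult_left_mono gap) simp_all
      finally show ?thesis .
    qed
  next
    show "(\<lambda>n. 2 * \<epsilon> n) \<longlonglongrightarrow> 0" using tendsto_mult_left[OF lim0, of 2] by simp
  qed
  then obtain l where l: "x \<longlonglongrightarrow> l" unfolding convergent_def by blast
  have "l \<in> S" using assms(1) x(1) l unfolding closed_sequential_limits by blast
  moreover have "(norm l)\<^sup>2 \<le> d"
  proof (rule LIMSEQ_le)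
    show "(\<lambda>n. (norm (x n))\<^sup>2) \<longlonglongrightarrow> (norm l)\<^sup>2" by (intro tendsto_intros l)
    show "(\<lambda>n. d + \<epsilon> n) \<longlonglongrightarrow> d" using tendsto_add[OF tendsto_const lim0] by simp
    show "\<exists>N. \<forall>n\<ge>N. (norm (x n))\<^sup>2 \<le> d + \<epsilon> n" using x(2) less_imp_le by blast
  qed
  then have "norm l \<le> norm y" if "y \<in> S" for y
    by (rule power2_le_imp_le[OF order_trans[OF _ d[OF that]]]) simp
  ultimately show ?thesis by blast
qed

lemma minimal_norm_point_unique:
  fixes S :: "'a::real_inner set"
  assumes "convex S" "x \<in> S" "y \<in> S" "\<forall>z\<in>S. norm x \<le> norm z" "\<forall>z\<in>S. norm y \<le> norm z"
  shows "x = y"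
proof -
  have eq: "norm x = norm y" using assms by (meson order_antisym)
  have "norm x \<le> norm ((1/2) *\<^sub>R x + (1/2) *\<^sub>R y)"
    using assms(4) convex_midpoint[OF assms(1-3)] by blast
  then have "(norm x)\<^sup>2 \<le> (norm ((1/2) *\<^sub>R x + (1/2) *\<^sub>R y))\<^sup>2" by (intro power_mono) auto
  from norm_diff_square_le_if_midpoint[OF this] show ?thesis using eq by simp
qed

text \<open>
  The vector \<open>x - m\<close> is the one of least norm in the affine subspace \<open>x - M\<close>; moving \<open>m\<close> inside \<open>M\<close>
  cannot shorten it, so it is orthogonal to \<open>M\<close>.
\<close>

lemma ex_orthogonal_projection:
  fixes M :: "'a::{real_inner,complete_space} set"
  assumes M: "closed M" "subspace M"
  shows "\<exists>m\<in>M. \<forall>y\<in>M. (x - m) \<bullet> y = 0"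
proof -
  let ?S = "(\<lambda>m. x - m) ` M"
  have S_eq: "?S = (+) x ` (uminus ` M)" by (auto simp: image_image)
  have "closed ?S" unfolding S_eq by (intro closed_translation closed_negations M)
  moreover have "convex ?S"
    unfolding S_eq by (intro convex_translation convex_negations subspace_imp_convex M)
  moreover have "?S \<noteq> {}" using subspace_0[OF M(2)] by blast
  ultimately obtain m where m: "m \<in> M" and min: "\<And>z. z \<in> M \<Longrightarrow> norm (x - m) \<le> norm (x - z)"
    using ex_minimal_norm_point[of ?S] by blast
  have "(x - m) \<bullet> y = 0" if y: "y \<in> M" for y
  proof (cases "y = 0")
    case False
    \<comment> \<open>this \<open>t\<close> minimizes the norm of \<open>(x - m) - t y\<close>\<close>
    define t where "t = ((x - m) \<bullet> y) / (y \<bullet> y)"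
    have "m + t *\<^sub>R y \<in> M" using m y M(2) by (intro subspace_add subspace_scale)
    then have "norm (x - m) \<le> norm ((x - m) - t *\<^sub>R y)" using min by (simp add: diff_diff_eq)
    then have "(norm (x - m))\<^sup>2 \<le> (norm ((x - m) - t *\<^sub>R y))\<^sup>2" by (intro power_mono) auto
    also have "\<dots> = (norm (x - m))\<^sup>2 - 2 * t * ((x - m) \<bullet> y) + t * t * (y \<bullet> y)"
      by (simp only: power2_norm_eq_inner)
        (simp add: inner_diff_left inner_diff_right inner_commute algebra_simps)
    also have "t * t * (y \<bullet> y) = t * ((x - m) \<bullet> y)" using False by (simp add: t_def)
    finally have "t * ((x - m) \<bullet> y) \<le> 0" by simp
    then have "t * ((x - m) \<bullet> y) * (y \<bullet> y) \<le> 0" by (rule mult_nonpos_nonneg) simp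
    also have "t * ((x - m) \<bullet> y) * (y \<bullet> y) = ((x - m) \<bullet> y)\<^sup>2"
      using False by (simp add: t_def power2_eq_square)
    finally show ?thesis by simp
  qed simp
  with m show ?thesis by blast
qed

text \<open>
  The last hypothesis says that \<open>p i\<close> is the orthogonal projection of \<open>x\<close> onto the line through
  \<open>p i\<close>.
\<close>

lemma bessel_finite:
  fixes p :: "'i \<Rightarrow> 'a::real_inner"
  assumes "finite F" "pairwise (\<lambda>i j. orthogonal (p i) (p j)) F"
    and "\<And>i. i \<in> F \<Longrightarrow> x \<bullet> p i = (norm (p i))\<^sup>2"
  shows "(\<Sum>i\<in>F. (norm (p i))\<^sup>2) \<le> (norm x)\<^sup>2"
proof -
  have "0 \<le> (norm (x - sum p F))\<^sup>2" by simp
  also have "\<dots> = (norm x)\<^sup>2 - 2 * (x \<bullet> sum p F) + (norm (sum p F))\<^sup>2"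
    by (simp add: power2_norm_eq_inner inner_diff_left inner_diff_right inner_commute)
  also have "x \<bullet> sum p F = (\<Sum>i\<in>F. (norm (p i))\<^sup>2)" using assms(3) by (simp add: inner_sum_right)
  also have "(norm (sum p F))\<^sup>2 = (\<Sum>i\<in>F. (norm (p i))\<^sup>2)"
    by (rule norm_sum_Pythagorean[OF assms(1,2)])
  finally show ?thesis by simp
qed

text \<open>
  By Bessel's inequality the squares of the inner products with a fixed vector are summable.
\<close>

lemma orthogonal_sequence_weakly_null:
  fixes e :: "nat \<Rightarrow> 'a::real_inner"
  assumes orth: "\<And>m n. m \<noteq> n \<Longrightarrow> e m \<bullet> e n = 0" and norm: "\<And>n. e n \<bullet> e n = d"
  shows "(\<lambda>n. e n \<bullet> z) \<longlonglongrightarrow> 0"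
proof (cases "d = 0")
  case True
  then have "e n = 0" for n using norm[of n] by simp
  then show ?thesis by simp
next
  case False
  then have d: "d > 0" using norm[of 0] inner_ge_zero[of "e 0"] by linarith
  \<comment> \<open>the projection of \<open>z\<close> onto the line through \<open>e n\<close>\<close>
  define p where "p n = ((e n \<bullet> z) / d) *\<^sub>R e n" for n
  have p: "(norm (p n))\<^sup>2 = (e n \<bullet> z)\<^sup>2 / d" for n
    using d norm[of n] by (simp only: power2_norm_eq_inner) (simp add: p_def power2_eq_square)
  have "summable (\<lambda>n. (norm (p n))\<^sup>2)"
  proof (rule bounded_imp_summable)
    fix n
    show "(\<Sum>k\<le>n. (norm (p k))\<^sup>2) \<le> (norm z)\<^sup>2"
    proof (rule bessel_finite)
      show "pairwise (\<lambda>i j. orthogonal (p i) (p j)) {..n}"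
        using orth by (auto simp: pairwise_def orthogonal_def p_def)
      show "z \<bullet> p i = (norm (p i))\<^sup>2" for i
        unfolding p by (simp add: p_def power2_eq_square inner_commute)
    qed simp
  qed simp
  then have "(\<lambda>n. (norm (p n))\<^sup>2) \<longlonglongrightarrow> 0" by (rule summable_LIMSEQ_zero)
  then have "(\<lambda>n. d * (norm (p n))\<^sup>2) \<longlonglongrightarrow> d * 0" by (intro tendsto_intros)
  then have "(\<lambda>n. (e n \<bullet> z)\<^sup>2) \<longlonglongrightarrow> 0" using d by (simp add: p)
  then have "(\<lambda>n. sqrt ((e n \<bullet> z)\<^sup>2)) \<longlonglongrightarrow> sqrt 0" by (intro tendsto_intros)
  then show ?thesis by (simp add: tendsto_rabs_zero_iff)
qed

text \<open>
  The series converges unconditionally though in general not absolutely; by Pythagoras the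
  squared distance of two nested partial sums is the difference of the partial sums of the squared
  norms.
\<close>

lemma orthogonal_has_sum:
  fixes x :: "'i \<Rightarrow> 'a::{real_inner,complete_space}"
  assumes orth: "pairwise (\<lambda>i j. orthogonal (x i) (x j)) R"
    and summable: "(\<lambda>i. (norm (x i))\<^sup>2) summable_on R"
  shows "\<exists>y. (x has_sum y) R \<and> (norm y)\<^sup>2 = (\<Sum>\<^sub>\<infinity>i\<in>R. (norm (x i))\<^sup>2)"
proof -
  define s where "s = (\<Sum>\<^sub>\<infinity>i\<in>R. (norm (x i))\<^sup>2)"
  have s: "((\<lambda>F. \<Sum>i\<in>F. (norm (x i))\<^sup>2) \<longlongrightarrow> s) (finite_subsets_at_top R)"
    using has_sum_infsum[OF summable] unfolding has_sum_def s_def .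
  have norm_sum: "(norm (sum x F))\<^sup>2 = (\<Sum>i\<in>F. (norm (x i))\<^sup>2)" if "finite F" "F \<subseteq> R" for F
    using that pairwise_subset[OF orth] by (intro norm_sum_Pythagorean)
  have "cauchy_filter (filtermap (sum x) (finite_subsets_at_top R))"
    unfolding cauchy_filter_metric_filtermap
  proof (intro allI impI)
    fix e :: real assume e: "e > 0"
    then have "\<forall>\<^sub>F F in finite_subsets_at_top R. s - e\<^sup>2 / 4 < (\<Sum>i\<in>F. (norm (x i))\<^sup>2)"
      by (intro order_tendstoD(1)[OF s]) simp
    then obtain F0 where F0: "finite F0" "F0 \<subseteq> R"
      and lower: "s - e\<^sup>2 / 4 < (\<Sum>i\<in>F0. (norm (x i))\<^sup>2)"
      unfolding eventually_finite_subsets_at_top by auto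
    have near: "norm (sum x F - sum x F0) < e / 2" if F: "finite F" "F0 \<subseteq> F" "F \<subseteq> R" for F
    proof -
      have "sum x F - sum x F0 = sum x (F - F0)" using F by (simp add: sum_diff)
      then have "(norm (sum x F - sum x F0))\<^sup>2 = (\<Sum>i\<in>F - F0. (norm (x i))\<^sup>2)"
        using F by (simp add: norm_sum subset_iff)
      also have "\<dots> = (\<Sum>i\<in>F. (norm (x i))\<^sup>2) - (\<Sum>i\<in>F0. (norm (x i))\<^sup>2)"
        using F F0 by (simp add: sum_diff)
      also have "(\<Sum>i\<in>F. (norm (x i))\<^sup>2) \<le> s"
        unfolding s_def using F summable by (intro finite_sum_le_infsum) auto
      finally have "(norm (sum x F - sum x F0))\<^sup>2 < (e / 2)\<^sup>2"
        using lower by (simp add: power_divide)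
      then show ?thesis by (rule power2_less_imp_less) (use e in simp)
    qed
    show "\<exists>P. eventually P (finite_subsets_at_top R) \<and>
        (\<forall>F F'. P F \<and> P F' \<longrightarrow> dist (sum x F) (sum x F') < e)"
    proof (intro exI[of _ "\<lambda>F. finite F \<and> F0 \<subseteq> F \<and> F \<subseteq> R"] conjI allI impI)
      show "\<forall>\<^sub>F F in finite_subsets_at_top R. finite F \<and> F0 \<subseteq> F \<and> F \<subseteq> R"
        unfolding eventually_finite_subsets_at_top using F0 by (intro exI[of _ F0]) simp
      fix F F' assume F: "(finite F \<and> F0 \<subseteq> F \<and> F \<subseteq> R) \<and> finite F' \<and> F0 \<subseteq> F' \<and> F' \<subseteq> R"
      then have "dist (sum x F) (sum x F0) < e / 2" "dist (sum x F') (sum x F0) < e / 2"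
        unfolding dist_norm using near by blast+
      then show "dist (sum x F) (sum x F') < e" by (rule dist_triangle_half_l)
    qed
  qed
  moreover have "complete (UNIV :: 'a set)"
    by (meson Cauchy_convergent UNIV_I complete_def convergent_def)
  ultimately obtain y where y: "(sum x \<longlongrightarrow> y) (finite_subsets_at_top R)"
    using complete_uniform[where S = "UNIV :: 'a set"] by (force simp: filterlim_def)
  have "((\<lambda>F. (norm (sum x F))\<^sup>2) \<longlongrightarrow> (norm y)\<^sup>2) (finite_subsets_at_top R)"
    by (intro tendsto_intros y)
  moreover have "((\<lambda>F. (norm (sum x F))\<^sup>2) \<longlongrightarrow> s) (finite_subsets_at_top R)"
    by (rule tendsto_cong[THEN iffD1, OF _ s])
      (auto simp: norm_sum intro: eventually_finite_subsets_at_top_weakI)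
  ultimately have "(norm y)\<^sup>2 = s" by (rule tendsto_unique[rotated]) simp
  with y show ?thesis unfolding has_sum_def s_def by blast
qed


text \<open>
  By Ramsey's theorem there is an infinite subset on which the inner product of distinct vectors is a
  constant \<open>r\<close>. For a sequence \<open>x\<close> in it the averages converge to a vector \<open>\<zeta>\<close> with
  \<open>\<zeta> \<bullet> x n = \<zeta> \<bullet> \<zeta> = r\<close>, so the differences \<open>x n - \<zeta>\<close> are mutually orthogonal and hence tend to \<open>0\<close>
  weakly. The norm drops because distinct vectors of the same norm satisfy \<open>r < \<rho>\<^sup>2\<close>.
\<close>

lemma ex_weak_limit_of_smaller_norm:
  fixes Z :: "'a::{real_inner,complete_space} set"
  assumes inf: "infinite Z" and norm: "\<And>x. x \<in> Z \<Longrightarrow> norm x = \<rho>"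
    and fin: "finite {x \<bullet> y | x y. x \<in> Z \<and> y \<in> Z}"
  obtains x :: "nat \<Rightarrow> 'a" and \<zeta> where "\<And>n. x n \<in> Z" "\<And>z. (\<lambda>n. x n \<bullet> z) \<longlonglongrightarrow> \<zeta> \<bullet> z"
    "norm \<zeta> < \<rho>" "\<zeta> \<in> closure (span Z)"
proof -
  define I where "I = {x \<bullet> y | x y. x \<in> Z \<and> y \<in> Z}"
  obtain h where h: "bij_betw h I {0..<card I}"
    using ex_bij_betw_finite_nat[OF fin] unfolding I_def by blast
  \<comment> \<open>the inner product \<open>x \<bullet> y\<close> expressed by the unordered pair \<open>{x, y}\<close> of vectors of norm \<open>\<rho>\<close>\<close>
  define colour where "colour A = h ((norm (\<Sum>A))\<^sup>2 / 2 - \<rho>\<^sup>2)" for A :: "'a set"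
  have colour: "colour {x, y} = h (x \<bullet> y)" if "x \<in> Z" "y \<in> Z" "x \<noteq> y" for x y
  proof -
    have "(norm (\<Sum>{x, y}))\<^sup>2 = (norm x)\<^sup>2 + (norm y)\<^sup>2 + 2 * (x \<bullet> y)"
      using that(3) by (simp add: power2_norm_eq_inner inner_simps inner_commute)
    also have "\<dots> = 2 * (\<rho>\<^sup>2 + x \<bullet> y)" unfolding norm[OF that(1)] norm[OF that(2)] by (simp only: algebra_simps mult_2)
    finally have "(norm (\<Sum>{x, y}))\<^sup>2 / 2 - \<rho>\<^sup>2 = x \<bullet> y" by (simp add: field_simps)
    then show ?thesis unfolding colour_def by (rule arg_cong)
  qed
  have inI: "x \<bullet> y \<in> I" if "x \<in> Z" "y \<in> Z" for x y using that unfolding I_def by blast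
  have "\<forall>x\<in>Z. \<forall>y\<in>Z. x \<noteq> y \<longrightarrow> colour {x, y} < card I"
  proof (intro ballI impI)
    fix x y assume xy: "x \<in> Z" "y \<in> Z" "x \<noteq> y"
    have "h (x \<bullet> y) \<in> {0..<card I}" by (rule bspec[OF bij_betwE[OF h] inI[OF xy(1,2)]])
    then show "colour {x, y} < card I" unfolding colour[OF xy] by (simp only: atLeastLessThan_iff)
  qed
  from Ramsey2[OF inf this] obtain Y t where "Y \<subseteq> Z \<and> infinite Y \<and> t < card I \<and>
      (\<forall>x\<in>Y. \<forall>y\<in>Y. x \<noteq> y \<longrightarrow> colour {x, y} = t)" by metis
  then have Y: "Y \<subseteq> Z" "infinite Y"
    and t: "\<And>x y. x \<in> Y \<Longrightarrow> y \<in> Y \<Longrightarrow> x \<noteq> y \<Longrightarrow> colour {x, y} = t" by metis+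
  obtain x :: "nat \<Rightarrow> 'a" where x: "inj x" "range x \<subseteq> Y"
    using infinite_countable_subset[OF Y(2)] by blast
  have xZ: "x n \<in> Z" for n using x(2) Y(1) by blast
  define r where "r = x 0 \<bullet> x 1"
  define a where "a = \<rho>\<^sup>2"
  have neq: "x i \<noteq> x j" if "i \<noteq> j" for i j using x(1) that by (meson injD)
  have off: "x i \<bullet> x j = r" if "i \<noteq> j" for i j
  proof -
    have "h (x i \<bullet> x j) = t" using t[of "x i" "x j"] colour[OF xZ xZ neq[OF that]] x(2) neq[OF that] by auto
    moreover have "h r = t"
      using t[of "x 0" "x 1"] colour[OF xZ xZ neq[of 0 1]] x(2) neq[of 0 1] by (auto simp: r_def)
    ultimately show ?thesis
      using h inI[OF xZ xZ] unfolding r_def bij_betw_def inj_on_def by metis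
  qed
  have diag: "x i \<bullet> x i = a" for i
    using norm[OF xZ] by (simp add: a_def power2_norm_eq_inner[symmetric])
  have ra: "r < a"
  proof -
    have "0 < (x 0 - x 1) \<bullet> (x 0 - x 1)" using neq[of 0 1] by simp
    also have "\<dots> = 2 * (a - r)"
      using off[of 0 1] off[of 1 0] diag by (simp add: inner_diff_left inner_diff_right)
    finally show ?thesis by simp
  qed
  define S where "S n = (1 / real (Suc n)) *\<^sub>R (\<Sum>i\<le>n. x i)" for n
  have xS: "x k \<bullet> S n = r + (a - r) / real (Suc n)" if "k \<le> n" for k n
  proof -
    have "(\<Sum>i\<le>n. x k \<bullet> x i) = (\<Sum>i\<le>n. r + (if i = k then a - r else 0))"
      by (intro sum.cong refl) (auto simp: off diag)
    also have "\<dots> = real (Suc n) * r + (a - r)" using that by (simp add: sum.distrib)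
    finally have "x k \<bullet> S n = (1 / real (Suc n)) * (real (Suc n) * r + (a - r))"
      unfolding S_def by (simp only: inner_scaleR_right inner_sum_right)
    then show ?thesis by (simp add: field_simps del: of_nat_Suc)
  qed
  have SS: "S m \<bullet> S n = r + (a - r) / real (Suc n)" if "m \<le> n" for m n
  proof -
    have "S m \<bullet> S n = (1 / real (Suc m)) * (\<Sum>i\<le>m. x i \<bullet> S n)"
      unfolding S_def[of m] by (simp only: inner_scaleR_left inner_sum_left)
    also have "(\<Sum>i\<le>m. x i \<bullet> S n) = (\<Sum>i\<le>m. r + (a - r) / real (Suc n))"
      using that by (intro sum.cong refl xS) simp
    finally show ?thesis by (simp del: of_nat_Suc)
  qed
  have lim0: "(\<lambda>n. (a - r) / real (Suc n)) \<longlonglongrightarrow> 0"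
    using tendsto_mult_right[OF LIMSEQ_Suc[OF lim_1_over_n], of "a - r"] by simp
  have "convergent S"
  proof (rule convergent_if_norm_diff_square_le)
    have le: "(norm (S m - S n))\<^sup>2 \<le> (a - r) / real (Suc m) + (a - r) / real (Suc n)" if "m \<le> n" for m n
    proof -
      have "(norm (S m - S n))\<^sup>2 = S m \<bullet> S m - 2 * (S m \<bullet> S n) + S n \<bullet> S n"
        by (simp add: power2_norm_eq_inner inner_diff_left inner_diff_right inner_commute)
      also have "\<dots> = (a - r) / real (Suc m) - (a - r) / real (Suc n)"
        using SS[of m m] SS[OF that] SS[of n n] by simp
      also have "\<dots> \<le> (a - r) / real (Suc m) + (a - r) / real (Suc n)" using ra by simp
      finally show ?thesis .
    qed
    fix m n
    show "(norm (S m - S n))\<^sup>2 \<le> (a - r) / real (Suc m) + (a - r) / real (Suc n)"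
      using le[of m n] le[of n m] by (cases "m \<le> n") (auto simp: norm_minus_commute add.commute)
  qed (rule lim0)
  then obtain \<zeta> where \<zeta>: "S \<longlonglongrightarrow> \<zeta>" unfolding convergent_def by blast
  have limr: "(\<lambda>n. r + (a - r) / real (Suc n)) \<longlonglongrightarrow> r" using tendsto_add[OF tendsto_const lim0] by simp
  have x\<zeta>: "x k \<bullet> \<zeta> = r" for k
  proof (rule LIMSEQ_unique)
    show "(\<lambda>n. x k \<bullet> S n) \<longlonglongrightarrow> x k \<bullet> \<zeta>" by (intro tendsto_intros \<zeta>)
    show "(\<lambda>n. x k \<bullet> S n) \<longlonglongrightarrow> r"
      by (rule Lim_transform_eventually[OF limr])
        (auto simp: eventually_sequentially xS simp del: of_nat_Suc intro!: exI[of _ k])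
  qed
  have "S n \<bullet> \<zeta> = r" for n
    unfolding S_def by (simp add: inner_sum_left x\<zeta> del: of_nat_Suc sum.atMost_Suc)
  moreover have "(\<lambda>n. S n \<bullet> \<zeta>) \<longlonglongrightarrow> \<zeta> \<bullet> \<zeta>" by (intro tendsto_intros \<zeta>)
  ultimately have \<zeta>\<zeta>: "\<zeta> \<bullet> \<zeta> = r" by (simp add: LIMSEQ_const_iff)
  have null: "(\<lambda>n. (x n - \<zeta>) \<bullet> z) \<longlonglongrightarrow> 0" for z
    by (rule orthogonal_sequence_weakly_null[where d = "a - r"])
      (simp_all add: inner_diff_left inner_diff_right off diag x\<zeta> \<zeta>\<zeta> inner_commute[of \<zeta> "x _"])
  have "(\<lambda>n. x n \<bullet> z) \<longlonglongrightarrow> \<zeta> \<bullet> z" for z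
    using tendsto_add[OF null[of z] tendsto_const[of "\<zeta> \<bullet> z"]] by (simp add: inner_diff_left)
  moreover have "norm \<zeta> < \<rho>"
  proof (rule power2_less_imp_less)
    show "(norm \<zeta>)\<^sup>2 < \<rho>\<^sup>2" using ra by (simp add: power2_norm_eq_inner \<zeta>\<zeta> a_def)
    show "0 \<le> \<rho>" using norm[OF xZ, of 0] norm_ge_zero by metis
  qed
  moreover have "\<zeta> \<in> closure (span Z)"
  proof -
    have "S n \<in> span Z" for n unfolding S_def by (intro span_scale span_sum span_base xZ)
    with \<zeta> show ?thesis unfolding closure_sequential by blast
  qed
  ultimately show ?thesis using that xZ by blast
qed


subsection \<open>Complex scalars\<close>

lemma scaleC_minus_one: "(-1) *\<^sub>C x = - x"
  using scaleC_of_real[of "-1" x] by simp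

lemma cinner_scaleC_right: "cinner x (a *\<^sub>C y) = cnj a * cinner x y"
  using cinner_commute[of x "a *\<^sub>C y"] cinner_commute[of x y] by (simp add: cinner_scaleC_left)

lemma cinner_minus_left: "cinner (- x) y = - cinner x y"
  using cinner_scaleC_left[of "-1" x y] by (simp add: scaleC_minus_one)

lemma cinner_diff_left: "cinner (x - y) z = cinner x z - cinner y z"
  using cinner_add_left[of x "- y" z] by (simp add: cinner_minus_left)

lemma cinner_zero_left [simp]: "cinner 0 x = 0"
  using cinner_diff_left[of x x x] by simp

text \<open>
  Both parts of the complex inner product are real inner products, so limits and orthogonality to
  complex subspaces reduce to the real case.
\<close>

lemma cinner_eq_inner: "cinner x y = Complex (x \<bullet> y) (x \<bullet> (\<i> *\<^sub>C y))"
proof -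
  have "Im (cinner x y) = Re (cinner x (\<i> *\<^sub>C y))" by (simp add: cinner_scaleC_right)
  then show ?thesis by (simp add: complex_eq_iff Re_cinner)
qed

lemma cinner_self: "cinner x x = of_real ((norm x)\<^sup>2)"
proof -
  have "Im (cinner x x) = 0" using arg_cong[OF cinner_commute[of x x], of Im] by simp
  then show ?thesis by (simp add: complex_eq_iff Re_cinner power2_norm_eq_inner)
qed

lemma cinner_eq_zero_iff: "cinner x x = 0 \<longleftrightarrow> x = 0"
  by (simp add: cinner_self)

lemma cinner_eq_zero_sym: "cinner x y = 0 \<longleftrightarrow> cinner y x = 0"
  using cinner_commute[of x y] by simp

lemma norm_scaleC: "norm (a *\<^sub>C x) = cmod a * norm (x :: 'h::complex_hilbert_space)"
proof (rule power2_eq_imp_eq)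
  have "complex_of_real ((norm (a *\<^sub>C x))\<^sup>2) = a * cnj a * of_real ((norm x)\<^sup>2)"
    by (simp only: cinner_self[symmetric] cinner_scaleC_left cinner_scaleC_right mult.assoc)
      (simp only: mult.left_commute)
  also have "\<dots> = complex_of_real ((cmod a * norm x)\<^sup>2)"
    by (simp add: complex_norm_square[symmetric] power_mult_distrib)
  finally show "(norm (a *\<^sub>C x))\<^sup>2 = (cmod a * norm x)\<^sup>2" by (simp only: of_real_eq_iff)
qed simp_all

lemma bounded_linear_scaleC: "bounded_linear (\<lambda>x :: 'h::complex_hilbert_space. a *\<^sub>C x)"
proof (rule bounded_linear_intro)
  fix x y :: 'h and r :: real
  show "a *\<^sub>C (x + y) = a *\<^sub>C x + a *\<^sub>C y" by (rule scaleC_add_right)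
  show "a *\<^sub>C (r *\<^sub>R x) = r *\<^sub>R (a *\<^sub>C x)"
    by (simp only: scaleC_of_real[symmetric] scaleC_scaleC mult.commute)
  show "norm (a *\<^sub>C x) \<le> norm x * cmod a" by (simp add: norm_scaleC)
qed

lemmas tendsto_scaleC = bounded_linear.tendsto[OF bounded_linear_scaleC]

lemma tendsto_cinner_left:
  fixes l z :: "'h::complex_hilbert_space"
  assumes "(f \<longlongrightarrow> l) F"
  shows "((\<lambda>n. cinner (f n) z) \<longlongrightarrow> cinner l z) F"
  unfolding cinner_eq_inner by (intro tendsto_intros assms)

subsection \<open>Closed complex subspaces\<close>

lemma closed_csubspace_imp_subspace: "closed_csubspace M \<Longrightarrow> subspace M"
  unfolding closed_csubspace_def subspace_def by (metis scaleC_of_real)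

lemma closed_csubspaceD:
  assumes "closed_csubspace M"
  shows "closed M" "0 \<in> M" "x \<in> M \<Longrightarrow> y \<in> M \<Longrightarrow> x + y \<in> M" "x \<in> M \<Longrightarrow> c *\<^sub>C x \<in> M"
    "x \<in> M \<Longrightarrow> y \<in> M \<Longrightarrow> x - y \<in> M"
  using assms subspace_diff[OF closed_csubspace_imp_subspace[OF assms]]
  unfolding closed_csubspace_def by auto

lemma closed_csubspace_Inter: "(\<And>M. M \<in> \<M> \<Longrightarrow> closed_csubspace M) \<Longrightarrow> closed_csubspace (\<Inter>\<M>)"
  unfolding closed_csubspace_def by (auto intro: closed_Inter)

lemma closed_csubspace_Int:
  "closed_csubspace M \<Longrightarrow> closed_csubspace N \<Longrightarrow> closed_csubspace (M \<inter> N)"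
  unfolding closed_csubspace_def by (auto intro: closed_Int)

lemma closed_csubspace_orthogonal: "closed_csubspace {x. \<forall>y\<in>S. cinner x y = 0}"
proof -
  have "closed {x. \<forall>y\<in>S. cinner x y = 0}"
    unfolding closed_sequential_limits
  proof (intro allI impI CollectI ballI)
    fix s l y assume s: "(\<forall>n. s n \<in> {x. \<forall>y\<in>S. cinner x y = 0}) \<and> s \<longlonglongrightarrow> l" and "y \<in> S"
    then have "(\<lambda>n. cinner (s n) y) \<longlonglongrightarrow> cinner l y" "\<And>n. cinner (s n) y = 0"
      using tendsto_cinner_left by blast+
    then show "cinner l y = 0" by (simp add: LIMSEQ_const_iff)
  qed
  then show ?thesis
    unfolding closed_csubspace_def by (simp add: cinner_add_left cinner_scaleC_left)
qed

lemma closed_csubspace_closure_span: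
  assumes "\<And>c x. x \<in> S \<Longrightarrow> c *\<^sub>C x \<in> span S"
  shows "closed_csubspace (closure (span S))"
proof -
  have add: "x + y \<in> closure (span S)" if xy: "x \<in> closure (span S)" "y \<in> closure (span S)" for x y
  proof -
    obtain s t where s: "\<And>n. s n \<in> span S" "s \<longlonglongrightarrow> x" and t: "\<And>n. t n \<in> span S" "t \<longlonglongrightarrow> y"
      using xy unfolding closure_sequential by blast
    show ?thesis unfolding closure_sequential
      by (intro exI[of _ "\<lambda>n. s n + t n"] conjI allI span_add tendsto_intros s t)
  qed
  have span: "c *\<^sub>C x \<in> span S" if "x \<in> span S" for c x
    using that
  proof (induction rule: span_induct_alt)
    case base
    show ?case by (simp add: linear_0[OF bounded_linear.linear[OF bounded_linear_scaleC]] span_zero)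
  next
    case (step r x y)
    have "c *\<^sub>C (r *\<^sub>R x + y) = r *\<^sub>R (c *\<^sub>C x) + c *\<^sub>C y"
      by (simp add: scaleC_add_right linear_scale[OF bounded_linear.linear[OF bounded_linear_scaleC]])
    then show ?case using step assms by (simp add: span_add span_scale)
  qed
  have "c *\<^sub>C x \<in> closure (span S)" if x: "x \<in> closure (span S)" for c x
  proof -
    obtain s where s: "\<And>n. s n \<in> span S" "s \<longlonglongrightarrow> x" using x unfolding closure_sequential by blast
    show ?thesis unfolding closure_sequential
      by (intro exI[of _ "\<lambda>n. c *\<^sub>C s n"] conjI allI span tendsto_scaleC s)
  qed
  moreover have "0 \<in> closure (span S)" using closure_subset span_zero by blast
  ultimately show ?thesis unfolding closed_csubspace_def using add by simp
qed

text \<open>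
  The closed complex linear span. Being an intersection, it is contained in every closed complex
  subspace that contains the generators, and this is how all its properties are obtained.
\<close>

definition closed_chull :: "'h::complex_hilbert_space set \<Rightarrow> 'h set"
  where "closed_chull S = \<Inter>{M. closed_csubspace M \<and> S \<subseteq> M}"

lemma closed_csubspace_closed_chull: "closed_csubspace (closed_chull S)"
  unfolding closed_chull_def by (rule closed_csubspace_Inter) blast

lemma subset_closed_chull: "S \<subseteq> closed_chull S"
  unfolding closed_chull_def by blast

lemma closed_chull_minimal: "closed_csubspace M \<Longrightarrow> S \<subseteq> M \<Longrightarrow> closed_chull S \<subseteq> M"
  unfolding closed_chull_def by blast

lemma orthogonal_closed_chull:
  assumes "x \<in> closed_chull S" "y \<in> closed_chull S'"
    "\<And>s t. s \<in> S \<Longrightarrow> t \<in> S' \<Longrightarrow> cinner s t = 0"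
  shows "cinner x y = 0"
proof -
  have "closed_chull S' \<subseteq> {z. \<forall>s\<in>S. cinner z s = 0}"
    using assms(3) cinner_eq_zero_sym by (intro closed_chull_minimal closed_csubspace_orthogonal) blast
  then have "closed_chull S \<subseteq> {z. \<forall>t\<in>closed_chull S'. cinner z t = 0}"
    using cinner_eq_zero_sym by (intro closed_chull_minimal closed_csubspace_orthogonal) blast
  then show ?thesis using assms by blast
qed


subsection \<open>Orthogonal projection\<close>

definition proj :: "'h::complex_hilbert_space set \<Rightarrow> 'h \<Rightarrow> 'h"
  where "proj M x = (SOME m. m \<in> M \<and> (\<forall>y\<in>M. cinner (x - m) y = 0))"

lemma proj:
  assumes M: "closed_csubspace M"
  shows proj_in: "proj M x \<in> M" and proj_orthogonal: "y \<in> M \<Longrightarrow> cinner (x - proj M x) y = 0"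
proof -
  obtain m where m: "m \<in> M" "\<And>y. y \<in> M \<Longrightarrow> (x - m) \<bullet> y = 0"
    using ex_orthogonal_projection[OF closed_csubspaceD(1)[OF M] closed_csubspace_imp_subspace[OF M]]
    by blast
  then have "\<exists>m. m \<in> M \<and> (\<forall>y\<in>M. cinner (x - m) y = 0)"
    using closed_csubspaceD(4)[OF M] by (auto simp: cinner_eq_inner complex_eq_iff)
  then have "proj M x \<in> M \<and> (\<forall>y\<in>M. cinner (x - proj M x) y = 0)"
    unfolding proj_def by (rule someI_ex)
  then show "proj M x \<in> M" "y \<in> M \<Longrightarrow> cinner (x - proj M x) y = 0" by blast+
qed

lemma proj_unique:
  assumes M: "closed_csubspace M" and m: "m \<in> M" "\<And>y. y \<in> M \<Longrightarrow> cinner (x - m) y = 0"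
  shows "proj M x = m"
proof -
  let ?d = "proj M x - m"
  have d: "?d \<in> M" by (intro closed_csubspaceD(5)[OF M] proj_in M m)
  have "cinner ?d ?d = cinner (x - m) ?d - cinner (x - proj M x) ?d"
    by (simp add: cinner_diff_left[symmetric])
  then have "cinner ?d ?d = 0" using m(2)[OF d] proj_orthogonal[OF M d] by simp
  then show ?thesis by (simp add: cinner_eq_zero_iff)
qed

lemma proj_add:
  assumes "closed_csubspace M"
  shows "proj M (x + y) = proj M x + proj M y"
proof (rule proj_unique[OF assms])
  show "proj M x + proj M y \<in> M" by (intro closed_csubspaceD(3)[OF assms] proj_in assms)
  show "cinner (x + y - (proj M x + proj M y)) z = 0" if "z \<in> M" for z
    using proj_orthogonal[OF assms that, of x] proj_orthogonal[OF assms that, of y]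
    by (simp add: add_diff_add cinner_add_left)
qed

lemma proj_scaleC:
  assumes "closed_csubspace M"
  shows "proj M (c *\<^sub>C x) = c *\<^sub>C proj M x"
proof (rule proj_unique[OF assms])
  show "c *\<^sub>C proj M x \<in> M" by (intro closed_csubspaceD(4)[OF assms] proj_in assms)
  show "cinner (c *\<^sub>C x - c *\<^sub>C proj M x) z = 0" if "z \<in> M" for z
    using proj_orthogonal[OF assms that, of x]
    by (simp add: cinner_diff_left cinner_scaleC_left right_diff_distrib[symmetric])
qed

lemma proj_eq_zero_iff:
  assumes "closed_csubspace M"
  shows "proj M x = 0 \<longleftrightarrow> (\<forall>y\<in>M. cinner x y = 0)"
proof
  assume "proj M x = 0"
  then show "\<forall>y\<in>M. cinner x y = 0" using proj_orthogonal[OF assms, of _ x] by simp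
next
  assume "\<forall>y\<in>M. cinner x y = 0"
  then show "proj M x = 0" by (intro proj_unique assms closed_csubspaceD(2)[OF assms]) auto
qed


section \<open>Roelcke precompact non-archimedean groups\<close>

text \<open>
  A topological group whose open subgroups form a neighbourhood base of the identity is called
  non-archimedean; for such a group, finiteness of all double coset spaces of open subgroups is Roelcke
  precompactness.
\<close>

locale roelcke_precompact_group = group G for G (structure) +
  fixes T :: "'a topology"
  assumes topspace_eq: "topspace T = carrier G"
    and ex_open_subgroup: "openin T W \<Longrightarrow> \<one> \<in> W \<Longrightarrow> \<exists>V. subgroup V G \<and> openin T V \<and> V \<subseteq> W"
    and finite_double_cosets: "subgroup V G \<Longrightarrow> openin T V \<Longrightarrow>
      \<exists>F. finite F \<and> F \<subseteq> carrier G \<and> (\<forall>g\<in>carrier G. \<exists>v\<in>V. \<exists>f\<in>F. \<exists>w\<in>V. g = v \<otimes> f \<otimes> w)"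

text \<open>
  A neighbourhood of the identity contains the pointwise stabilizer of some finite tuple \<open>xs\<close>. Two
  elements \<open>f\<close> and \<open>g\<close> lie in the same double coset of this stabilizer as soon as the concatenated
  tuples \<open>xs @ f xs\<close> and \<open>xs @ g xs\<close> lie in the same orbit, and by oligomorphy there are finitely many
  orbits of tuples of this length.
\<close>

lemma oligomorphic_imp_roelcke_precompact:
  fixes G (structure)
  assumes "oligomorphic_group G T"
  shows "roelcke_precompact_group G T"
proof -
  from assms obtain X :: "nat set" and P \<phi> where G: "group G" and top: "topspace T = carrier G"
    and olig: "oligomorphic_permutation_group X P" and iso: "\<phi> \<in> iso G (BijGroup X\<lparr>carrier := P\<rparr>)"
    and homeo: "homeomorphic_map T (permutation_group_topology X P) \<phi>"
    unfolding oligomorphic_group_def topological_group_def by blast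
  interpret group G by (rule G)
  have P: "P \<subseteq> Bij X"
    using olig subgroup.subset unfolding oligomorphic_permutation_group_def BijGroup_def by fastforce
  have bij: "bij_betw \<phi> (carrier G) P" and hom: "\<phi> \<in> hom G (BijGroup X\<lparr>carrier := P\<rparr>)"
    using iso unfolding iso_def by simp_all
  have \<phi>P: "\<phi> g \<in> P" if "g \<in> carrier G" for g using bij that by (rule bij_betw_apply)
  then have Bij: "\<phi> g \<in> extensional X" "bij_betw (\<phi> g) X X" if "g \<in> carrier G" for g
    using P that unfolding Bij_def by blast+
  have X: "\<phi> g x \<in> X" if "g \<in> carrier G" "x \<in> X" for g x
    using bij_betw_apply[OF Bij(2)[OF that(1)] that(2)] .
  have mult: "\<phi> (g \<otimes> h) x = \<phi> g (\<phi> h x)" if "g \<in> carrier G" "h \<in> carrier G" "x \<in> X" for g h x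
  proof -
    have "\<phi> (g \<otimes> h) = \<phi> g \<otimes>\<^bsub>BijGroup X\<lparr>carrier := P\<rparr>\<^esub> \<phi> h" by (rule hom_mult[OF hom that(1,2)])
    also have "\<dots> = compose X (\<phi> g) (\<phi> h)"
      using \<phi>P[OF that(1)] \<phi>P[OF that(2)] P by (auto simp: BijGroup_def)
    finally show ?thesis using that(3) by (simp add: compose_def)
  qed
  have one: "\<phi> \<one> x = x" if "x \<in> X" for x
  proof (rule inj_onD[OF bij_betw_imp_inj_on[OF Bij(2)[OF one_closed]]])
    show "\<phi> \<one> (\<phi> \<one> x) = \<phi> \<one> x" using mult[OF one_closed one_closed that] by simp
  qed (use that X in auto)
  define stab where "stab A = {g \<in> carrier G. \<forall>x\<in>A. \<phi> g x = x}" for A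
  have subgroup: "subgroup (stab A) G" if "A \<subseteq> X" for A
  proof (rule subgroupI)
    show "stab A \<subseteq> carrier G" by (auto simp: stab_def)
    show "stab A \<noteq> {}" using one that by (auto simp: stab_def intro!: exI[of _ \<one>])
    fix g assume g: "g \<in> stab A"
    then have gG: "g \<in> carrier G" by (simp add: stab_def)
    have "\<phi> (inv g) x = x" if "x \<in> A" for x
    proof -
      have "\<phi> (inv g) x = \<phi> (inv g) (\<phi> g x)" using g that by (simp add: stab_def)
      also have "\<dots> = \<phi> (inv g \<otimes> g) x"
        by (rule mult[symmetric]) (use gG that \<open>A \<subseteq> X\<close> in auto)
      finally show ?thesis using one that \<open>A \<subseteq> X\<close> gG by auto
    qed
    then show "inv g \<in> stab A" using gG by (simp add: stab_def)
    fix h assume h: "h \<in> stab A"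
    show "g \<otimes> h \<in> stab A" using g h mult that by (auto simp: stab_def subset_iff)
  qed
  have cont: "continuous_map T (product_topology (\<lambda>_. discrete_topology X) X) \<phi>"
    using homeomorphic_imp_continuous_map[OF homeo]
    unfolding permutation_group_topology_def by (simp add: continuous_map_in_subtopology)
  have open1: "openin T {g \<in> carrier G. \<phi> g x = x}" if "x \<in> X" for x
  proof -
    have "continuous_map T (discrete_topology X) ((\<lambda>f. f x) \<circ> \<phi>)"
      by (rule continuous_map_compose[OF cont continuous_map_product_projection[OF that]])
    from openin_continuous_map_preimage[OF this, of "{x}"] show ?thesis
      using that by (simp add: top)
  qed
  have open_stab: "openin T (stab A)" if "finite A" "A \<subseteq> X" for A
  proof (cases "A = {}")
    case True
    then show ?thesis using openin_topspace[of T] by (simp add: stab_def top)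
  next
    case False
    then have "stab A = (\<Inter>x\<in>A. {g \<in> carrier G. \<phi> g x = x})" by (auto simp: stab_def)
    then show ?thesis using that False open1 by (auto intro!: openin_Inter)
  qed
  have small: "\<exists>A. finite A \<and> A \<subseteq> X \<and> stab A \<subseteq> W" if W: "openin T W" "\<one> \<in> W" for W
  proof -
    have "openin (permutation_group_topology X P) (\<phi> ` W)"
      using homeomorphic_imp_open_map[OF homeo] W(1) unfolding open_map_def by blast
    then obtain W' where W': "openin (product_topology (\<lambda>_. discrete_topology X) X) W'"
      and eq: "\<phi> ` W = W' \<inter> P"
      unfolding permutation_group_topology_def openin_subtopology by blast
    have "\<phi> \<one> \<in> W'" using eq W(2) by blast
    then obtain U where U: "finite {i \<in> X. U i \<noteq> X}" "\<phi> \<one> \<in> Pi\<^sub>E X U" "Pi\<^sub>E X U \<subseteq> W'"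
      using W' unfolding openin_product_topology_alt by force
    have "g \<in> W" if g: "g \<in> stab {i \<in> X. U i \<noteq> X}" for g
    proof -
      have gG: "g \<in> carrier G" using g by (simp add: stab_def)
      have "\<phi> g i \<in> U i" if "i \<in> X" for i
      proof (cases "U i = X")
        case True
        then show ?thesis using X[OF gG that] by simp
      next
        case False
        then have "\<phi> g i = \<phi> \<one> i" using g that one by (simp add: stab_def)
        then show ?thesis using U(2) that by auto
      qed
      then have "\<phi> g \<in> Pi\<^sub>E X U" using Bij(1)[OF gG] by (simp add: PiE_iff)
      then have "\<phi> g \<in> \<phi> ` W" unfolding eq using U(3) \<phi>P[OF gG] by blast
      then obtain w where w: "w \<in> W" "\<phi> g = \<phi> w" by blast
      then have "w \<in> carrier G" using openin_subset[OF W(1)] top by blast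
      then show ?thesis using inj_onD[OF bij_betw_imp_inj_on[OF bij] w(2) gG] w(1) by simp
    qed
    then show ?thesis using U(1) by blast
  qed
  show ?thesis
  proof
    show "topspace T = carrier G" by (rule top)
    show "\<exists>V. subgroup V G \<and> openin T V \<and> V \<subseteq> W" if "openin T W" "\<one> \<in> W" for W
      using small[OF that] subgroup open_stab by blast
    fix V assume V: "subgroup V G" "openin T V"
    obtain A where A: "finite A" "A \<subseteq> X" "stab A \<subseteq> V"
      using small[OF V(2) subgroup.one_closed[OF V(1)]] by blast
    obtain xs where xs: "set xs = A" using finite_list[OF A(1)] by blast
    let ?B = "BijGroup X\<lparr>carrier := P\<rparr>"
    define orb where "orb g = orbit ?B map (xs @ map (\<phi> g) xs)" for g
    have "orb g \<in> orbits ?B {ys. set ys \<subseteq> X \<and> length ys = length xs + length xs} map"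
      if g: "g \<in> carrier G" for g
    proof -
      have "\<forall>x\<in>A. x \<in> X \<and> \<phi> g x \<in> X" using A(2) X[OF g] by blast
      then show ?thesis
        unfolding orb_def orbits_def
        by (intro CollectI exI conjI refl) (auto simp: xs)
    qed
    then have "orb ` carrier G \<subseteq> orbits ?B {ys. set ys \<subseteq> X \<and> length ys = length xs + length xs} map"
      by (rule image_subsetI)
    then have "finite (orb ` carrier G)"
      using olig unfolding oligomorphic_permutation_group_def by (meson finite_subset)
    from finite_subset_image[OF this subset_refl] obtain F
      where F: "F \<subseteq> carrier G" "finite F" "orb ` carrier G = orb ` F" by blast
    have "\<exists>v\<in>V. \<exists>f\<in>F. \<exists>w\<in>V. g = v \<otimes> f \<otimes> w" if g: "g \<in> carrier G" for g
    proof -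
      obtain f where f: "f \<in> F" "orb g = orb f" using F(3) g by blast
      then have fG: "f \<in> carrier G" using F(1) by blast
      have "map (\<phi> \<one>) (xs @ map (\<phi> g) xs) = xs @ map (\<phi> g) xs"
        using A(2) xs one X[OF g] by (auto simp: subset_iff map_idI)
      then have "xs @ map (\<phi> g) xs \<in> orb g"
        unfolding orb_def orbit_def using \<phi>P[OF one_closed] by simp (metis)
      then obtain p where p: "p \<in> P" "xs @ map (\<phi> g) xs = map p (xs @ map (\<phi> f) xs)"
        unfolding f(2) unfolding orb_def orbit_def by auto
      then obtain k where k: "k \<in> carrier G" "p = \<phi> k" using bij unfolding bij_betw_def by blast
      have fixA: "\<phi> k x = x" and gkf: "\<phi> g x = \<phi> k (\<phi> f x)" if "x \<in> A" for x
      proof -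
        have "xs = map (\<phi> k) xs \<and> map (\<phi> g) xs = map (\<phi> k \<circ> \<phi> f) xs"
          using p(2) unfolding k(2) map_append map_map by (rule append_eq_append_conv[THEN iffD1, rotated]) simp
        then show "\<phi> k x = x" "\<phi> g x = \<phi> k (\<phi> f x)"
          using that xs map_eq_conv[of id xs "\<phi> k"] map_eq_conv[of "\<phi> g" xs "\<phi> k \<circ> \<phi> f"]
          by (metis id_apply list.map_id, metis comp_apply)
      qed
      have kV: "k \<in> V" using A(3) fixA k(1) by (auto simp: stab_def)
      define w where "w = inv (k \<otimes> f) \<otimes> g"
      have "\<phi> w x = x" if "x \<in> A" for x
      proof -
        have xX: "x \<in> X" using that A(2) by blast
        have "\<phi> w x = \<phi> (inv (k \<otimes> f)) (\<phi> (k \<otimes> f) x)"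
          unfolding w_def using mult k(1) fG g xX gkf[OF that] by simp
        also have "\<dots> = \<phi> (inv (k \<otimes> f) \<otimes> (k \<otimes> f)) x"
          using k(1) fG xX by (intro mult[symmetric]) auto
        finally show ?thesis using k(1) fG one[OF xX] by simp
      qed
      then have "w \<in> V" using A(3) k(1) fG g by (auto simp: stab_def w_def)
      moreover have "g = k \<otimes> f \<otimes> w" unfolding w_def using k(1) fG g by (simp add: m_assoc[symmetric])
      ultimately show ?thesis using kV f(1) by blast
    qed
    then show "\<exists>F. finite F \<and> F \<subseteq> carrier G \<and> (\<forall>g\<in>carrier G. \<exists>v\<in>V. \<exists>f\<in>F. \<exists>w\<in>V. g = v \<otimes> f \<otimes> w)"
      using F(1,2) by blast
  qed
qed


section \<open>Unitary representations\<close>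

locale unitary_representation = roelcke_precompact_group G T for G (structure) and T +
  fixes H :: "'h::complex_hilbert_space set" and \<pi> :: "'a \<Rightarrow> 'h \<Rightarrow> 'h"
  assumes rep: "unitary_rep G T H \<pi>"
begin

lemma csubspace: "closed_csubspace H"
  and rep_closed: "g \<in> carrier G \<Longrightarrow> x \<in> H \<Longrightarrow> \<pi> g x \<in> H"
  and rep_add: "g \<in> carrier G \<Longrightarrow> x \<in> H \<Longrightarrow> y \<in> H \<Longrightarrow> \<pi> g (x + y) = \<pi> g x + \<pi> g y"
  and rep_scaleC: "g \<in> carrier G \<Longrightarrow> x \<in> H \<Longrightarrow> \<pi> g (c *\<^sub>C x) = c *\<^sub>C \<pi> g x"
  and rep_cinner: "g \<in> carrier G \<Longrightarrow> x \<in> H \<Longrightarrow> y \<in> H \<Longrightarrow> cinner (\<pi> g x) (\<pi> g y) = cinner x y"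
  and rep_one: "x \<in> H \<Longrightarrow> \<pi> \<one> x = x"
  and rep_mult: "g \<in> carrier G \<Longrightarrow> h \<in> carrier G \<Longrightarrow> x \<in> H \<Longrightarrow> \<pi> (g \<otimes> h) x = \<pi> g (\<pi> h x)"
  and rep_continuous: "x \<in> H \<Longrightarrow> continuous_map T euclidean (\<lambda>g. \<pi> g x)"
  using rep unfolding unitary_rep_def by blast+

lemmas H_closed = closed_csubspaceD[OF csubspace]

lemma rep_inv: "g \<in> carrier G \<Longrightarrow> x \<in> H \<Longrightarrow> \<pi> (inv g) (\<pi> g x) = x"
  and rep_inv': "g \<in> carrier G \<Longrightarrow> x \<in> H \<Longrightarrow> \<pi> g (\<pi> (inv g) x) = x"
  using rep_mult[of "inv g" g x] rep_mult[of g "inv g" x] rep_one by simp_all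

lemma cinner_rep_left: "g \<in> carrier G \<Longrightarrow> x \<in> H \<Longrightarrow> y \<in> H \<Longrightarrow> cinner (\<pi> g x) y = cinner x (\<pi> (inv g) y)"
  using rep_cinner[of g x "\<pi> (inv g) y"] by (simp add: rep_inv' rep_closed)

lemma norm_rep: "g \<in> carrier G \<Longrightarrow> x \<in> H \<Longrightarrow> norm (\<pi> g x) = norm x"
  using rep_cinner[of g x x] unfolding cinner_self of_real_eq_iff by simp

lemma rep_diff:
  assumes "g \<in> carrier G" "x \<in> H" "y \<in> H"
  shows "\<pi> g (x - y) = \<pi> g x - \<pi> g y"
  using rep_add[OF assms(1) H_closed(5)[OF assms(2,3)] assms(3)] by (simp add: algebra_simps)

lemma rep_scaleR: "g \<in> carrier G \<Longrightarrow> x \<in> H \<Longrightarrow> \<pi> g (r *\<^sub>R x) = r *\<^sub>R \<pi> g x"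
  using rep_scaleC[of g x "complex_of_real r"] by (simp add: scaleC_of_real)

lemma tendsto_rep:
  assumes g: "g \<in> carrier G" and s: "\<And>n. s n \<in> H" "l \<in> H" "s \<longlonglongrightarrow> l"
  shows "(\<lambda>n. \<pi> g (s n)) \<longlonglongrightarrow> \<pi> g l"
proof -
  have "(\<lambda>n. norm (s n - l)) \<longlonglongrightarrow> 0" using s(3) by (simp add: LIM_zero tendsto_norm_zero)
  then have "(\<lambda>n. norm (\<pi> g (s n) - \<pi> g l)) \<longlonglongrightarrow> 0"
    using s by (simp add: rep_diff[OF g, symmetric] norm_rep[OF g] H_closed(5))
  then show ?thesis by (simp add: LIM_zero_iff tendsto_norm_zero_iff)
qed

lemma closed_vimage_rep:
  assumes "g \<in> carrier G" "closed S"
  shows "closed {x \<in> H. \<pi> g x \<in> S}"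
  unfolding closed_sequential_limits
proof (intro allI impI)
  fix s l assume s: "(\<forall>n. s n \<in> {x \<in> H. \<pi> g x \<in> S}) \<and> s \<longlonglongrightarrow> l"
  then have l: "l \<in> H" using H_closed(1) unfolding closed_sequential_limits by blast
  then have lim: "(\<lambda>n. \<pi> g (s n)) \<longlonglongrightarrow> \<pi> g l" using s by (intro tendsto_rep assms) auto
  have "\<pi> g l \<in> S" by (rule closed_sequentially[OF assms(2) _ lim]) (use s in auto)
  with l show "l \<in> {x \<in> H. \<pi> g x \<in> S}" by simp
qed

lemma closed_csubspace_vimage_rep:
  assumes g: "g \<in> carrier G" and M: "closed_csubspace M"
  shows "closed_csubspace {x \<in> H. \<pi> g x \<in> M}"
proof -
  have "\<pi> g 0 = 0" using rep_diff[OF g H_closed(2) H_closed(2)] by simp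
  then show ?thesis
    unfolding closed_csubspace_def
    using closed_vimage_rep[OF g closed_csubspaceD(1)[OF M]] closed_csubspaceD(2-4)[OF M] H_closed(2-4)
    by (simp add: rep_add[OF g] rep_scaleC[OF g])
qed

lemma rep_closed_chull:
  assumes g: "g \<in> carrier G" and S: "S \<subseteq> H" and S': "\<And>x. x \<in> S \<Longrightarrow> \<pi> g x \<in> closed_chull S'"
    and x: "x \<in> closed_chull S"
  shows "\<pi> g x \<in> closed_chull S'"
proof -
  have "closed_chull S \<subseteq> {x \<in> H. \<pi> g x \<in> closed_chull S'}"
    using S S' by (intro closed_chull_minimal closed_csubspace_vimage_rep g closed_csubspace_closed_chull) auto
  then show ?thesis using x by blast
qed

lemma closed_csubspace_fixed_by:
  assumes g: "g \<in> carrier G"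
  shows "closed_csubspace {x \<in> H. \<pi> g x = x}"
proof -
  have "closed {x \<in> H. \<pi> g x = x}"
    unfolding closed_sequential_limits
  proof (intro allI impI)
    fix s l assume s: "(\<forall>n. s n \<in> {x \<in> H. \<pi> g x = x}) \<and> s \<longlonglongrightarrow> l"
    then have l: "l \<in> H" using H_closed(1) unfolding closed_sequential_limits by blast
    then have "(\<lambda>n. \<pi> g (s n)) \<longlonglongrightarrow> \<pi> g l" using s by (intro tendsto_rep g) auto
    then have "s \<longlonglongrightarrow> \<pi> g l" using s by simp
    then have "\<pi> g l = l" using s LIMSEQ_unique by blast
    with l show "l \<in> {x \<in> H. \<pi> g x = x}" by simp
  qed
  moreover have "\<pi> g 0 = 0" using rep_diff[OF g H_closed(2) H_closed(2)] by simp
  ultimately show ?thesis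
    unfolding closed_csubspace_def using H_closed(2-4)
    by (simp add: rep_add[OF g] rep_scaleC[OF g])
qed

definition invariant :: "'h set \<Rightarrow> bool"
  where "invariant M \<longleftrightarrow> closed_csubspace M \<and> M \<subseteq> H \<and> (\<forall>g\<in>carrier G. \<pi> g ` M \<subseteq> M)"

lemma invariantD:
  assumes "invariant M"
  shows "closed_csubspace M" "M \<subseteq> H" "g \<in> carrier G \<Longrightarrow> x \<in> M \<Longrightarrow> \<pi> g x \<in> M"
  using assms unfolding invariant_def by auto

lemma invariant_imp_unitary_rep: "invariant M \<Longrightarrow> unitary_rep G T M \<pi>"
  unfolding unitary_rep_def
  using invariantD rep_add rep_scaleC rep_cinner rep_one rep_mult rep_continuous by (simp add: subset_iff)

lemma irreducible_iff_invariant: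
  "irreducible_unitary_rep G T M \<pi> \<and> M \<subseteq> H \<longleftrightarrow>
    invariant M \<and> M \<noteq> {0} \<and> (\<forall>N. invariant N \<and> N \<subseteq> M \<longrightarrow> N = {0} \<or> N = M)"
proof -
  have rep: "unitary_rep G T M \<pi> \<and> M \<subseteq> H \<longleftrightarrow> invariant M"
  proof
    assume "unitary_rep G T M \<pi> \<and> M \<subseteq> H"
    then show "invariant M" unfolding invariant_def unitary_rep_def by (metis image_subsetI)
  qed (metis invariant_imp_unitary_rep invariantD(2))
  have sub: "invariant N \<longleftrightarrow> closed_csubspace N \<and> (\<forall>g\<in>carrier G. \<pi> g ` N \<subseteq> N)"
    if "invariant M" "N \<subseteq> M" for N
    using that invariantD(2) unfolding invariant_def by auto
  show ?thesis unfolding irreducible_unitary_rep_def using rep sub by metis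
qed

lemma invariant_closed_chull:
  assumes "S \<subseteq> H" "\<And>g x. g \<in> carrier G \<Longrightarrow> x \<in> S \<Longrightarrow> \<pi> g x \<in> S"
  shows "invariant (closed_chull S)"
  unfolding invariant_def
proof (intro conjI ballI image_subsetI)
  show "closed_chull S \<subseteq> H" by (intro closed_chull_minimal csubspace assms)
  show "\<pi> g x \<in> closed_chull S" if "g \<in> carrier G" "x \<in> closed_chull S" for g x
    by (rule rep_closed_chull[OF that(1) assms(1) _ that(2)])
      (rule subsetD[OF subset_closed_chull assms(2)[OF that(1)]])
qed (rule closed_csubspace_closed_chull)

lemma invariant_orthogonal:
  assumes "invariant M" "invariant N"
  shows "invariant {x \<in> M. \<forall>y\<in>N. cinner x y = 0}"
proof -
  have "{x \<in> M. \<forall>y\<in>N. cinner x y = 0} = M \<inter> {x. \<forall>y\<in>N. cinner x y = 0}" by blast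
  then have "closed_csubspace {x \<in> M. \<forall>y\<in>N. cinner x y = 0}"
    using closed_csubspace_Int[OF invariantD(1)[OF assms(1)] closed_csubspace_orthogonal] by simp
  moreover have "cinner (\<pi> g x) y = 0"
    if "g \<in> carrier G" "x \<in> M" "\<forall>y\<in>N. cinner x y = 0" "y \<in> N" for g x y
    using that invariantD[OF assms(1)] invariantD[OF assms(2)]
    by (simp add: cinner_rep_left subset_iff)
  ultimately show ?thesis using invariantD[OF assms(1)] unfolding invariant_def by auto
qed

lemma proj_rep:
  assumes M: "closed_csubspace M" "M \<subseteq> H" and g: "g \<in> carrier G" and x: "x \<in> H"
    and inv: "\<And>y. y \<in> M \<Longrightarrow> \<pi> g y \<in> M" "\<And>y. y \<in> M \<Longrightarrow> \<pi> (inv g) y \<in> M"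
  shows "proj M (\<pi> g x) = \<pi> g (proj M x)"
proof (rule proj_unique[OF M(1)])
  have p: "proj M x \<in> M" "proj M x \<in> H" using proj_in[OF M(1)] M(2) by auto
  then show "\<pi> g (proj M x) \<in> M" by (intro inv)
  fix y assume y: "y \<in> M"
  have "cinner (\<pi> g x - \<pi> g (proj M x)) y = cinner (\<pi> g (x - proj M x)) y"
    using rep_diff[OF g x p(2)] by simp
  also have "\<dots> = cinner (x - proj M x) (\<pi> (inv g) y)"
    using y M(2) by (intro cinner_rep_left g H_closed x p) auto
  also have "\<dots> = 0" by (intro proj_orthogonal M inv y)
  finally show "cinner (\<pi> g x - \<pi> g (proj M x)) y = 0" .
qed


subsection \<open>Vectors fixed by an open subgroup\<close>

definition fixed :: "'a set \<Rightarrow> 'h set"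
  where "fixed V = {x \<in> H. \<forall>v\<in>V. \<pi> v x = x}"

lemma closed_csubspace_fixed:
  assumes "V \<subseteq> carrier G"
  shows "closed_csubspace (fixed V)"
proof -
  have "fixed V = \<Inter>(insert H ((\<lambda>v. {x \<in> H. \<pi> v x = x}) ` V))" unfolding fixed_def by auto
  also have "closed_csubspace \<dots>"
    using assms csubspace closed_csubspace_fixed_by by (intro closed_csubspace_Inter) auto
  finally show ?thesis .
qed

text \<open>
  An open subgroup \<open>V\<close> that moves a nonzero vector \<open>x\<close> by at most half its norm keeps the closed convex
  hull of \<open>V x\<close> away from \<open>0\<close>. The group \<open>V\<close> acts on this hull by isometries, so it fixes its unique
  point of least norm.
\<close>

lemma ex_fixed_vector:
  assumes "H \<noteq> {0}"
  shows "\<exists>V \<xi>. subgroup V G \<and> openin T V \<and> \<xi> \<in> fixed V \<and> \<xi> \<noteq> 0"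
proof -
  obtain x where x: "x \<in> H" "x \<noteq> 0" using assms H_closed(2) by blast
  define r where "r = norm x / 2"
  have r: "r < norm x" "0 < r" using x(2) by (simp_all add: r_def)
  let ?W = "{g \<in> carrier G. \<pi> g x \<in> ball x r}"
  have "openin T ?W"
    using openin_continuous_map_preimage[OF rep_continuous[OF x(1)], of "ball x r"]
    by (simp add: topspace_eq)
  moreover have "\<one> \<in> ?W" using x(1) r by (simp add: rep_one)
  ultimately obtain V where V: "subgroup V G" "openin T V" "V \<subseteq> ?W"
    using ex_open_subgroup by blast
  have VG: "v \<in> carrier G" if "v \<in> V" for v using that V(3) by blast
  define S where "S = closure (convex hull ((\<lambda>v. \<pi> v x) ` V))"
  have S: "closed S" "convex S" "S \<noteq> {}"
    using subgroup.one_closed[OF V(1)] by (auto simp: S_def)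
  have S_minimal: "S \<subseteq> C" if "closed C" "convex C" "\<And>v. v \<in> V \<Longrightarrow> \<pi> v x \<in> C" for C
    unfolding S_def using that by (intro closure_minimal hull_minimal) auto
  have SH: "S \<subseteq> H"
    using H_closed(1) subspace_imp_convex[OF closed_csubspace_imp_subspace[OF csubspace]] rep_closed VG x
    by (intro S_minimal) auto
  have gen: "\<pi> v x \<in> S" if "v \<in> V" for v
    unfolding S_def using that by (intro subsetD[OF closure_subset] hull_inc) auto
  have inv: "\<pi> v y \<in> S" if v: "v \<in> V" and y: "y \<in> S" for v y
  proof -
    have "S \<subseteq> {y \<in> H. \<pi> v y \<in> S}"
    proof (rule S_minimal)
      show "closed {y \<in> H. \<pi> v y \<in> S}" by (intro closed_vimage_rep VG v S)
      show "convex {y \<in> H. \<pi> v y \<in> S}"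
      proof (rule convexI)
        fix y z and s t :: real
        assume yz: "y \<in> {y \<in> H. \<pi> v y \<in> S}" "z \<in> {y \<in> H. \<pi> v y \<in> S}" and st: "0 \<le> s" "0 \<le> t" "s + t = 1"
        have "s *\<^sub>R y + t *\<^sub>R z \<in> H"
          using yz by (intro H_closed(3)) (auto simp: scaleC_of_real[symmetric] H_closed(4))
        moreover have "\<pi> v (s *\<^sub>R y + t *\<^sub>R z) = s *\<^sub>R \<pi> v y + t *\<^sub>R \<pi> v z"
          using yz H_closed(4)[of _ "complex_of_real _"]
          by (simp add: rep_add[OF VG[OF v]] rep_scaleR[OF VG[OF v]] scaleC_of_real)
        moreover have "s *\<^sub>R \<pi> v y + t *\<^sub>R \<pi> v z \<in> S" using yz st by (intro convexD[OF S(2)]) auto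
        ultimately show "s *\<^sub>R y + t *\<^sub>R z \<in> {y \<in> H. \<pi> v y \<in> S}" by simp
      qed
      show "\<pi> w x \<in> {y \<in> H. \<pi> v y \<in> S}" if w: "w \<in> V" for w
        using gen[OF subgroup.m_closed[OF V(1) v w]] rep_closed[OF VG[OF w] x(1)]
        by (simp add: rep_mult VG v w x(1))
    qed
    then show ?thesis using y by blast
  qed
  obtain \<xi> where \<xi>: "\<xi> \<in> S" "\<forall>y\<in>S. norm \<xi> \<le> norm y" using ex_minimal_norm_point[OF S] by blast
  have \<xi>H: "\<xi> \<in> H" using \<xi>(1) SH by blast
  have "\<pi> v \<xi> = \<xi>" if v: "v \<in> V" for v
  proof (rule minimal_norm_point_unique[OF S(2) inv[OF v \<xi>(1)] \<xi>(1)])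
    show "\<forall>z\<in>S. norm (\<pi> v \<xi>) \<le> norm z" using \<xi>(2) by (simp add: norm_rep[OF VG[OF v] \<xi>H])
  qed (rule \<xi>(2))
  moreover have "\<xi> \<noteq> 0"
  proof
    assume "\<xi> = 0"
    moreover have "S \<subseteq> cball x r" using V(3) by (intro S_minimal) auto
    ultimately show False using \<xi>(1) r by (auto simp: dist_norm)
  qed
  ultimately have "\<xi> \<in> fixed V \<and> \<xi> \<noteq> 0" unfolding fixed_def using \<xi>H by blast
  then show ?thesis using V by blast
qed

end


section \<open>Complete reducibility\<close>

text \<open>
  Imposing orthogonality to one more vector lowers the dimension by at most one.
\<close>

lemma subset_span_finite_if_separated:
  fixes S :: "'v::real_inner set"
  assumes "finite Y" "subspace S" "\<And>z. z \<in> S \<Longrightarrow> (\<forall>y\<in>Y. z \<bullet> y = 0) \<Longrightarrow> z = 0"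
  shows "\<exists>B. finite B \<and> S \<subseteq> span B"
  using assms
proof (induction Y arbitrary: S rule: finite_induct)
  case empty
  then have "S \<subseteq> span {}" by auto
  then show ?case by blast
next
  case (insert y Y)
  define S' where "S' = {z \<in> S. z \<bullet> y = 0}"
  have "subspace S'"
    using insert.prems(1) unfolding S'_def subspace_def by (auto simp: inner_add_left)
  moreover have "z = 0" if "z \<in> S'" "\<forall>y\<in>Y. z \<bullet> y = 0" for z
    using that insert.prems(2)[of z] by (auto simp: S'_def)
  ultimately obtain B where B: "finite B" "S' \<subseteq> span B" using insert.IH by blast
  show ?case
  proof (cases "\<exists>s\<in>S. s \<bullet> y \<noteq> 0")
    case False
    then have "S = S'" by (auto simp: S'_def)
    then show ?thesis using B by blast
  next
    case True
    then obtain s where s: "s \<in> S" "s \<bullet> y \<noteq> 0" by blast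
    have "z \<in> span (insert s B)" if z: "z \<in> S" for z
    proof -
      define t where "t = (z \<bullet> y) / (s \<bullet> y)"
      have "(z - t *\<^sub>R s) \<bullet> y = 0" using s(2) by (simp add: t_def inner_diff_left)
      moreover have "z - t *\<^sub>R s \<in> S" using insert.prems(1) z s(1) by (intro subspace_diff subspace_scale)
      ultimately have "z - t *\<^sub>R s \<in> span B" using B(2) by (auto simp: S'_def)
      then show ?thesis unfolding span_insert by blast
    qed
    then show ?thesis using B(1) by (intro exI[of _ "insert s B"]) auto
  qed
qed

text \<open>
  In a space of infinite dimension, \<^const>\<open>dim\<close> is \<open>0\<close> for subspaces without a finite basis; the
  finite spanning set excludes these.
\<close>

lemma dim_less_dim:
  fixes S S' :: "'v::real_vector set"
  assumes fin: "finite B" "S' \<subseteq> span B" and S: "subspace S" "S \<subseteq> S'" and w: "w \<in> S'" "w \<notin> S"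
  shows "dim S < dim S'"
proof -
  obtain B1 where B1: "B1 \<subseteq> S" "independent B1" "S \<subseteq> span B1" "card B1 = dim S"
    using basis_exists by metis
  obtain B2 where B2: "B2 \<subseteq> S'" "independent B2" "S' \<subseteq> span B2" "card B2 = dim S'"
    using basis_exists by metis
  have "B2 \<subseteq> span B" using B2(1) fin(2) by blast
  then have finB2: "finite B2" using independent_span_bound[OF fin(1) B2(2)] by blast
  have "w \<notin> span B1" using span_minimal[OF B1(1) S(1)] w(2) by blast
  then have ind: "independent (insert w B1)" and "w \<notin> B1" using B1(2) independent_insertI span_base by blast+
  have "insert w B1 \<subseteq> span B2" using B1(1) B2(3) S(2) w(1) by blast
  from independent_span_bound[OF finB2 ind this]
  have "finite B1" "card (insert w B1) \<le> card B2" by simp_all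
  then show ?thesis using B1(4) B2(4) \<open>w \<notin> B1\<close> by simp
qed

context unitary_representation
begin

definition orb :: "'h \<Rightarrow> 'h set"
  where "orb \<xi> = (\<lambda>g. \<pi> g \<xi>) ` carrier G"

lemma orb_subset: "\<xi> \<in> H \<Longrightarrow> orb \<xi> \<subseteq> H"
  unfolding orb_def using rep_closed by blast

lemma mem_orb_self: "\<xi> \<in> H \<Longrightarrow> \<xi> \<in> orb \<xi>"
  unfolding orb_def using rep_one[of \<xi>] by (metis image_eqI one_closed)

lemma rep_orb: "\<xi> \<in> H \<Longrightarrow> g \<in> carrier G \<Longrightarrow> x \<in> orb \<xi> \<Longrightarrow> \<pi> g x \<in> orb \<xi>"
  unfolding orb_def using rep_mult by (smt (verit) image_iff m_closed)

lemma invariant_cyclic: "\<xi> \<in> H \<Longrightarrow> invariant (closed_chull (orb \<xi>))"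
  by (intro invariant_closed_chull orb_subset rep_orb)

lemma proj_fixed_vector:
  assumes M: "invariant M" and V: "V \<subseteq> carrier G" "subgroup V G" and \<xi>: "\<xi> \<in> fixed V"
  shows "proj M \<xi> \<in> M \<inter> fixed V"
proof -
  have p: "proj M \<xi> \<in> M" by (rule proj_in[OF invariantD(1)[OF M]])
  have "\<pi> v (proj M \<xi>) = proj M \<xi>" if v: "v \<in> V" for v
  proof -
    have "proj M (\<pi> v \<xi>) = \<pi> v (proj M \<xi>)"
      using \<xi> v V by (intro proj_rep invariantD[OF M]) (auto simp: fixed_def)
    then show ?thesis using \<xi> v by (simp add: fixed_def)
  qed
  then show ?thesis using p invariantD(2)[OF M] by (auto simp: fixed_def)
qed

lemma cinner_orbit_zero:
  assumes M: "invariant M" and \<xi>: "\<xi> \<in> H" and orth: "\<And>y. y \<in> M \<Longrightarrow> cinner \<xi> y = 0"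
    and "x \<in> closed_chull (orb \<xi>)" "y \<in> M"
  shows "cinner x y = 0"
proof -
  have "cinner s t = 0" if "s \<in> orb \<xi>" "t \<in> M" for s t
    using that orth \<xi> invariantD[OF M] by (auto simp: orb_def cinner_rep_left subset_iff)
  then show ?thesis
    using orthogonal_closed_chull[OF assms(4), of y M] subset_closed_chull assms(5) by blast
qed

text \<open>
  For a fixed vector \<open>z\<close> the number \<open>\<langle>z, g \<xi>\<rangle>\<close> depends only on the double coset of \<open>g\<close>, and all these
  numbers together determine \<open>z\<close> within the subspace generated by the orbit.
\<close>

lemma fixed_cyclic_finite_dimensional:
  assumes V: "subgroup V G" "openin T V" and \<xi>: "\<xi> \<in> fixed V"
  shows "\<exists>B. finite B \<and> closed_chull (orb \<xi>) \<inter> fixed V \<subseteq> span B"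
proof -
  let ?Z = "closed_chull (orb \<xi>)"
  have VG: "V \<subseteq> carrier G" by (rule subgroup.subset[OF V(1)])
  have \<xi>H: "\<xi> \<in> H" using \<xi> by (simp add: fixed_def)
  obtain F where F: "finite F" "F \<subseteq> carrier G"
      "\<forall>g\<in>carrier G. \<exists>v\<in>V. \<exists>f\<in>F. \<exists>w\<in>V. g = v \<otimes> f \<otimes> w"
    using finite_double_cosets[OF V] by blast
  \<comment> \<open>real orthogonality to \<open>w\<close> and to \<open>\<i> w\<close> is complex orthogonality to \<open>w\<close>\<close>
  define Y where "Y = (\<lambda>f. \<pi> f \<xi>) ` F \<union> (\<lambda>f. \<i> *\<^sub>C \<pi> f \<xi>) ` F"
  show ?thesis
  proof (rule subset_span_finite_if_separated)
    show "finite Y" using F(1) by (simp add: Y_def)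
    show "subspace (?Z \<inter> fixed V)"
      by (intro closed_csubspace_imp_subspace closed_csubspace_Int closed_csubspace_closed_chull
          closed_csubspace_fixed VG)
    fix z assume z: "z \<in> ?Z \<inter> fixed V" and zY: "\<forall>y\<in>Y. z \<bullet> y = 0"
    then have zH: "z \<in> H" by (simp add: fixed_def)
    have zf: "cinner z (\<pi> f \<xi>) = 0" if "f \<in> F" for f
      using zY that by (simp add: cinner_eq_inner Y_def complex_eq_iff)
    have "cinner z (\<pi> g \<xi>) = 0" if g: "g \<in> carrier G" for g
    proof -
      obtain v f w where vfw: "v \<in> V" "f \<in> F" "w \<in> V" "g = v \<otimes> f \<otimes> w" using F(3) g by blast
      have vG: "v \<in> carrier G" "f \<in> carrier G" "w \<in> carrier G" using vfw VG F(2) by blast+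
      have "\<pi> g \<xi> = \<pi> v (\<pi> f \<xi>)"
        using vfw(3) \<xi> \<xi>H vG unfolding vfw(4) by (simp add: rep_mult rep_closed fixed_def)
      then have "cinner z (\<pi> g \<xi>) = cinner (\<pi> v z) (\<pi> v (\<pi> f \<xi>))"
        using z vfw(1) by (simp add: fixed_def)
      also have "\<dots> = cinner z (\<pi> f \<xi>)" by (intro rep_cinner rep_closed vG zH \<xi>H)
      finally show ?thesis using zf[OF vfw(2)] by simp
    qed
    then have "orb \<xi> \<subseteq> {x. \<forall>y\<in>{z}. cinner x y = 0}" using cinner_eq_zero_sym by (auto simp: orb_def)
    then have "?Z \<subseteq> {x. \<forall>y\<in>{z}. cinner x y = 0}" by (intro closed_chull_minimal closed_csubspace_orthogonal)
    then have "cinner z z = 0" using z by blast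
    then show "z = 0" by (simp add: cinner_eq_zero_iff)
  qed
qed

text \<open>
  Within the subspace generated by a fixed vector, every nonzero invariant subspace contains a nonzero
  fixed vector. If \<open>M\<close> has a proper nonzero invariant subspace \<open>N\<close>, then the complement of \<open>N\<close> in \<open>M\<close>
  contains such a vector as well, so the fixed vectors of \<open>N\<close> form a space of smaller dimension than
  those of \<open>M\<close>. This cannot happen when the dimension for \<open>M\<close> is the least possible.
\<close>

lemma ex_irreducible_subrep:
  assumes "H \<noteq> {0}"
  shows "\<exists>M\<subseteq>H. irreducible_unitary_rep G T M \<pi>"
proof -
  obtain V \<xi> where V: "subgroup V G" "openin T V" and \<xi>: "\<xi> \<in> fixed V" "\<xi> \<noteq> 0"
    using ex_fixed_vector[OF assms] by blast
  have VG: "V \<subseteq> carrier G" by (rule subgroup.subset[OF V(1)])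
  have \<xi>H: "\<xi> \<in> H" using \<xi> by (simp add: fixed_def)
  define Z where "Z = closed_chull (orb \<xi>)"
  have Z: "invariant Z" unfolding Z_def by (rule invariant_cyclic[OF \<xi>H])
  obtain B where B: "finite B" "Z \<inter> fixed V \<subseteq> span B"
    using fixed_cyclic_finite_dimensional[OF V \<xi>(1)] unfolding Z_def by blast
  have nonzero: "\<exists>p\<in>M \<inter> fixed V. p \<noteq> 0" if M: "invariant M" "M \<subseteq> Z" "M \<noteq> {0}" for M
  proof (rule bexI[OF _ proj_fixed_vector[OF M(1) VG V(1) \<xi>(1)]], rule notI)
    assume "proj M \<xi> = 0"
    then have orth: "cinner \<xi> y = 0" if "y \<in> M" for y
      using that by (simp add: proj_eq_zero_iff invariantD(1)[OF M(1)])
    have "y = 0" if "y \<in> M" for y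
    proof -
      have "y \<in> closed_chull (orb \<xi>)" using that M(2) unfolding Z_def by blast
      then have "cinner y y = 0" using cinner_orbit_zero[OF M(1) \<xi>H orth _ that] by blast
      then show ?thesis by (simp add: cinner_eq_zero_iff)
    qed
    then show False using M(3) closed_csubspaceD(2)[OF invariantD(1)[OF M(1)]] by blast
  qed
  define P where "P M \<longleftrightarrow> invariant M \<and> M \<subseteq> Z \<and> M \<noteq> {0}" for M
  have "\<xi> \<in> Z" unfolding Z_def using mem_orb_self[OF \<xi>H] subset_closed_chull by blast
  then have "P Z" unfolding P_def using Z \<xi>(2) by blast
  then obtain M where M: "P M" and min: "\<And>N. P N \<Longrightarrow> dim (M \<inter> fixed V) \<le> dim (N \<inter> fixed V)"
    using ex_has_least_nat[of P Z "\<lambda>M. dim (M \<inter> fixed V)"] by blast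
  have Minv: "invariant M" and MZ: "M \<subseteq> Z" and M0: "M \<noteq> {0}" using M unfolding P_def by blast+
  have "N = {0} \<or> N = M" if N: "invariant N" "N \<subseteq> M" for N
  proof (rule ccontr)
    assume neg: "\<not> (N = {0} \<or> N = M)"
    then have PN: "P N" using N MZ unfolding P_def by blast
    obtain x where x: "x \<in> M" "x \<notin> N" using neg N(2) by blast
    define N' where "N' = {x \<in> M. \<forall>y\<in>N. cinner x y = 0}"
    have N': "invariant N'" unfolding N'_def by (rule invariant_orthogonal[OF Minv N(1)])
    have pN: "proj N x \<in> N" by (rule proj_in[OF invariantD(1)[OF N(1)]])
    then have "x - proj N x \<in> M" using N(2) x by (intro closed_csubspaceD(5)[OF invariantD(1)[OF Minv]]) auto
    then have "x - proj N x \<in> N'"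
      unfolding N'_def using proj_orthogonal[OF invariantD(1)[OF N(1)]] by simp
    moreover have "x - proj N x \<noteq> 0" using pN x by auto
    ultimately have "N' \<noteq> {0}" by blast
    moreover have "N' \<subseteq> Z" using MZ unfolding N'_def by blast
    ultimately obtain w where w: "w \<in> N' \<inter> fixed V" "w \<noteq> 0" using nonzero[OF N'] by blast
    have "w \<notin> N"
    proof
      assume "w \<in> N"
      then have "cinner w w = 0" using w unfolding N'_def by blast
      then show False using w(2) by (simp add: cinner_eq_zero_iff)
    qed
    have "dim (N \<inter> fixed V) < dim (M \<inter> fixed V)"
    proof (rule dim_less_dim[OF B(1)])
      show "M \<inter> fixed V \<subseteq> span B" using B(2) MZ by blast
      show "subspace (N \<inter> fixed V)"
        by (intro closed_csubspace_imp_subspace closed_csubspace_Int invariantD(1)[OF N(1)]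
            closed_csubspace_fixed VG)
      show "N \<inter> fixed V \<subseteq> M \<inter> fixed V" using N(2) by blast
      show "w \<in> M \<inter> fixed V" using w unfolding N'_def by blast
      show "w \<notin> N \<inter> fixed V" using \<open>w \<notin> N\<close> by blast
    qed
    then show False using min[OF PN] by simp
  qed
  with Minv M0 have "irreducible_unitary_rep G T M \<pi> \<and> M \<subseteq> H"
    by (intro irreducible_iff_invariant[THEN iffD2] conjI allI impI) simp_all
  then show ?thesis by blast
qed


subsection \<open>Decomposition into irreducible representations\<close>

lemma subrepresentation: "invariant M \<Longrightarrow> unitary_representation G T M \<pi>"
  by unfold_locales (rule invariant_imp_unitary_rep)

text \<open>
  The orthogonal complement of a maximal orthogonal family of irreducible subrepresentations contains no
  irreducible subrepresentation, so it is zero.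
\<close>

lemma direct_sum: "direct_sum_of_irreducibles G T H \<pi>"
proof -
  define good where "good \<M> \<longleftrightarrow> (\<forall>M\<in>\<M>. M \<subseteq> H \<and> irreducible_unitary_rep G T M \<pi>) \<and>
    (\<forall>M\<in>\<M>. \<forall>N\<in>\<M>. M \<noteq> N \<longrightarrow> (\<forall>x\<in>M. \<forall>y\<in>N. cinner x y = 0))" for \<M>
  have "\<exists>\<M>\<in>Collect good. \<forall>\<N>\<in>Collect good. \<M> \<subseteq> \<N> \<longrightarrow> \<N> = \<M>"
  proof (rule subset_Zorn')
    fix \<C> assume C: "subset.chain (Collect good) \<C>"
    have "\<exists>\<M>\<in>\<C>. M \<in> \<M> \<and> N \<in> \<M>" if "M \<in> \<Union>\<C>" "N \<in> \<Union>\<C>" for M N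
      using that C unfolding subset_chain_def by blast
    moreover have "good \<M>" if "\<M> \<in> \<C>" for \<M> using that C unfolding subset_chain_def by blast
    ultimately show "\<Union>\<C> \<in> Collect good" unfolding good_def mem_Collect_eq by (smt (verit))
  qed
  then obtain \<M> where good: "good \<M>" and max: "\<And>\<N>. good \<N> \<Longrightarrow> \<M> \<subseteq> \<N> \<Longrightarrow> \<N> = \<M>" by blast
  have inv: "invariant M" if M: "M \<in> \<M>" for M
  proof -
    have "irreducible_unitary_rep G T M \<pi> \<and> M \<subseteq> H" using good M unfolding good_def by blast
    from irreducible_iff_invariant[THEN iffD1, OF this] show ?thesis by (rule conjunct1)
  qed
  have irr: "irreducible_unitary_rep G T M \<pi>" if "M \<in> \<M>" for M
    using good that unfolding good_def by simp
  have MH: "M \<subseteq> H" if "M \<in> \<M>" for M using invariantD(2)[OF inv[OF that]] .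
  define L where "L = closure (span (\<Union>\<M>))"
  have Lc: "closed_csubspace L"
    unfolding L_def
  proof (rule closed_csubspace_closure_span)
    fix c x assume "x \<in> \<Union>\<M>"
    then obtain M where "M \<in> \<M>" "x \<in> M" by blast
    then have "c *\<^sub>C x \<in> \<Union>\<M>" using closed_csubspaceD(4)[OF invariantD(1)[OF inv]] by blast
    then show "c *\<^sub>C x \<in> span (\<Union>\<M>)" by (rule span_base)
  qed
  have genL: "\<Union>\<M> \<subseteq> L" unfolding L_def by (rule order_trans[OF span_superset closure_subset])
  have LH: "L \<subseteq> H"
    unfolding L_def using MH H_closed(1) closed_csubspace_imp_subspace[OF csubspace]
    by (intro closure_minimal span_minimal) auto
  have L_eq: "L = closed_chull (\<Union>\<M>)"
  proof
    show "L \<subseteq> closed_chull (\<Union>\<M>)"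
      unfolding L_def
      by (intro closure_minimal span_minimal subset_closed_chull closed_csubspace_imp_subspace
          closed_csubspaceD(1) closed_csubspace_closed_chull)
    show "closed_chull (\<Union>\<M>) \<subseteq> L" by (rule closed_chull_minimal[OF Lc genL])
  qed
  have "invariant L"
    unfolding L_eq using MH inv invariantD(3) by (intro invariant_closed_chull) blast+
  moreover have H: "invariant H" unfolding invariant_def using csubspace rep_closed by auto
  moreover define N where "N = {x \<in> H. \<forall>y\<in>L. cinner x y = 0}"
  ultimately have Ninv: "invariant N" using invariant_orthogonal by simp
  have "H = L"
  proof (rule ccontr)
    assume "H \<noteq> L"
    then obtain x where x: "x \<in> H" "x \<notin> L" using LH by blast
    have pL: "proj L x \<in> L" by (rule proj_in[OF Lc])
    then have "x - proj L x \<in> N" unfolding N_def using LH x H_closed(5) proj_orthogonal[OF Lc] by auto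
    moreover have "x - proj L x \<noteq> 0" using pL x by auto
    ultimately have "N \<noteq> {0}" by blast
    from unitary_representation.ex_irreducible_subrep[OF subrepresentation[OF Ninv] this]
    obtain M where M: "M \<subseteq> N" "irreducible_unitary_rep G T M \<pi>" by blast
    have orth: "cinner x y = 0" if "x \<in> M" "y \<in> M'" "M' \<in> \<M>" for x y M'
      using that M(1) genL unfolding N_def by blast
    have "M \<subseteq> H" using M(1) unfolding N_def by blast
    have "good (insert M \<M>)"
      unfolding good_def
    proof (intro conjI ballI impI)
      fix A assume "A \<in> insert M \<M>"
      then show "A \<subseteq> H" "irreducible_unitary_rep G T A \<pi>"
        using MH irr M(2) \<open>M \<subseteq> H\<close> by (metis insertE)+
    next
      fix A B x y
      assume AB: "A \<in> insert M \<M>" "B \<in> insert M \<M>" "A \<noteq> B" and xy: "x \<in> A" "y \<in> B"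
      show "cinner x y = 0"
      proof (cases "A = M")
        case True
        then show ?thesis using orth AB xy by blast
      next
        case False
        show ?thesis
        proof (cases "B = M")
          case True
          then have "cinner y x = 0" using orth False AB xy by blast
          then show ?thesis by (rule cinner_eq_zero_sym[THEN iffD1])
        next
          case False
          then show ?thesis using good AB xy \<open>A \<noteq> M\<close> unfolding good_def by blast
        qed
      qed
    qed
    then have "M \<in> \<M>" using max by blast
    moreover have "closed_csubspace M" "M \<noteq> {0}"
      using M(2) unfolding irreducible_unitary_rep_def unitary_rep_def by blast+
    ultimately obtain m where "m \<in> M" "M \<in> \<M>" "m \<noteq> 0" using closed_csubspaceD(2) by blast
    then have "cinner m m = 0" using orth by blast
    then show False using \<open>m \<noteq> 0\<close> by (simp add: cinner_eq_zero_iff)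
  qed
  then show ?thesis
    unfolding direct_sum_of_irreducibles_def L_def using good unfolding good_def by metis
qed

end


section \<open>Orbits of vectors\<close>

context unitary_representation
begin

definition isotropy :: "'h \<Rightarrow> 'a set"
  where "isotropy x = {g \<in> carrier G. \<pi> g x = x}"

lemma subgroup_isotropy:
  assumes x: "x \<in> H"
  shows "subgroup (isotropy x) G"
proof (rule subgroupI)
  show "isotropy x \<noteq> {}" using rep_one[OF x] by (auto simp: isotropy_def)
  fix g assume g: "g \<in> isotropy x"
  then have gG: "g \<in> carrier G" and gx: "\<pi> g x = x" by (auto simp: isotropy_def)
  have "\<pi> (inv g) x = x" using rep_inv[OF gG x] gx by simp
  then show "inv g \<in> isotropy x" using gG by (simp add: isotropy_def)
  show "g \<otimes> h \<in> isotropy x" if "h \<in> isotropy x" for h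
    using gG gx that x by (simp add: isotropy_def rep_mult)
qed (auto simp: isotropy_def)

definition coefficients :: "'h \<Rightarrow> complex set"
  where "coefficients x = (\<lambda>g. cinner (\<pi> g x) x) ` carrier G"

lemma cinner_orbit_in_coefficients:
  assumes x: "x \<in> H" and g: "g \<in> carrier G" "h \<in> carrier G"
  shows "cinner (\<pi> g x) (\<pi> h x) \<in> coefficients x"
proof -
  have "cinner (\<pi> (inv h \<otimes> g) x) x = cinner (\<pi> (inv h) (\<pi> g x)) x"
    using x g by (simp add: rep_mult)
  also have "\<dots> = cinner (\<pi> g x) (\<pi> h x)"
    using x g cinner_rep_left[of "inv h" "\<pi> g x" x] by (simp add: rep_closed)
  finally show ?thesis unfolding coefficients_def using g
    by (intro image_eqI[of _ _ "inv h \<otimes> g"]) auto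
qed

text \<open>
  The coefficient at \<open>g\<close> depends only on the double coset of \<open>g\<close>.
\<close>

lemma finite_coefficients_fixed:
  assumes V: "subgroup V G" "openin T V" and \<xi>: "\<xi> \<in> fixed V"
  shows "finite (coefficients \<xi>)"
proof -
  obtain F where F: "finite F" "F \<subseteq> carrier G"
      "\<forall>g\<in>carrier G. \<exists>v\<in>V. \<exists>f\<in>F. \<exists>w\<in>V. g = v \<otimes> f \<otimes> w"
    using finite_double_cosets[OF V] by blast
  have \<xi>H: "\<xi> \<in> H" and \<xi>V: "\<And>v. v \<in> V \<Longrightarrow> \<pi> v \<xi> = \<xi>" using \<xi> by (auto simp: fixed_def)
  have "cinner (\<pi> g \<xi>) \<xi> \<in> (\<lambda>f. cinner (\<pi> f \<xi>) \<xi>) ` F" if g: "g \<in> carrier G" for g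
  proof -
    obtain v f w where vfw: "v \<in> V" "f \<in> F" "w \<in> V" "g = v \<otimes> f \<otimes> w" using F(3) g by blast
    have vG: "v \<in> carrier G" "f \<in> carrier G" "w \<in> carrier G"
      using vfw subgroup.subset[OF V(1)] F(2) by blast+
    have "cinner (\<pi> g \<xi>) \<xi> = cinner (\<pi> v (\<pi> f \<xi>)) (\<pi> v \<xi>)"
      using vfw(1,3) \<xi>H vG unfolding vfw(4) by (simp add: rep_mult rep_closed \<xi>V)
    also have "\<dots> = cinner (\<pi> f \<xi>) \<xi>" by (intro rep_cinner rep_closed vG \<xi>H)
    finally show ?thesis using vfw(2) by blast
  qed
  then have "coefficients \<xi> \<subseteq> (\<lambda>f. cinner (\<pi> f \<xi>) \<xi>) ` F" unfolding coefficients_def by (rule image_subsetI)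
  then show ?thesis by (rule finite_subset[OF _ finite_imageI[OF F(1)]])
qed

lemma norm_in_coefficients: "x \<in> H \<Longrightarrow> of_real ((norm x)\<^sup>2) \<in> coefficients x"
  using cinner_orbit_in_coefficients[of x \<one> \<one>] by (simp add: rep_one cinner_self)

text \<open>
  The distances from \<open>x\<close> to the points of its orbit form a finite set, so that a point of the orbit
  close enough to \<open>x\<close> equals \<open>x\<close>.
\<close>

lemma openin_isotropy:
  assumes x: "x \<in> H" and fin: "finite (coefficients x)"
  shows "openin T (isotropy x)"
proof -
  define D where "D = (\<lambda>g. norm (\<pi> g x - x)) ` carrier G"
  have norm_eq: "norm (\<pi> g x - x) = sqrt (2 * (norm x)\<^sup>2 - 2 * Re (cinner (\<pi> g x) x))"
    if "g \<in> carrier G" for g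
  proof -
    have "(norm (\<pi> g x - x))\<^sup>2 = (norm (\<pi> g x))\<^sup>2 + (norm x)\<^sup>2 - 2 * Re (cinner (\<pi> g x) x)"
      by (simp add: power2_norm_eq_inner inner_diff_left inner_diff_right inner_commute Re_cinner)
    also have "\<dots> = 2 * (norm x)\<^sup>2 - 2 * Re (cinner (\<pi> g x) x)"
      by (simp add: norm_rep[OF that x])
    finally show ?thesis by (metis norm_ge_zero real_sqrt_unique)
  qed
  have "D \<subseteq> (\<lambda>c. sqrt (2 * (norm x)\<^sup>2 - 2 * Re c)) ` coefficients x"
    unfolding D_def coefficients_def image_image using norm_eq by (simp add: image_subset_iff)
  then have "finite D" by (rule finite_subset[OF _ finite_imageI[OF fin]])
  define e where "e = Min (insert 1 (D - {0}))"
  have e_le: "e \<le> d" if "d \<in> D" "d \<noteq> 0" for d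
    unfolding e_def using \<open>finite D\<close> that by (intro Min_le) auto
  have "e \<in> insert 1 (D - {0})" unfolding e_def using \<open>finite D\<close> by (intro Min_in) auto
  then have "e > 0" unfolding D_def by auto
  have "isotropy x = {g \<in> topspace T. \<pi> g x \<in> ball x e}"
  proof (intro Set.set_eqI iffI)
    fix g assume "g \<in> isotropy x"
    then show "g \<in> {g \<in> topspace T. \<pi> g x \<in> ball x e}"
      using \<open>e > 0\<close> by (simp add: isotropy_def topspace_eq)
  next
    fix g assume g: "g \<in> {g \<in> topspace T. \<pi> g x \<in> ball x e}"
    then have gG: "g \<in> carrier G" by (simp add: topspace_eq)
    have "norm (\<pi> g x - x) < e" using g by (simp add: dist_norm norm_minus_commute)
    moreover have "norm (\<pi> g x - x) \<in> D" unfolding D_def using gG by blast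
    ultimately have "norm (\<pi> g x - x) = 0" using e_le by (meson not_less)
    then show "g \<in> isotropy x" using gG by (simp add: isotropy_def)
  qed
  then show ?thesis
    using openin_continuous_map_preimage[OF rep_continuous[OF x], of "ball x e"] by simp
qed

text \<open>
  The inverses of elements of a right coset \<open>S r\<close> are \<open>r\<inverse> s\<close> with \<open>s \<in> S\<close>; thus the \<open>D\<close>-orbit is
  covered by finitely many translates of the \<open>S\<close>-orbit.
\<close>

lemma finite_orbit_of_finite_index:
  assumes S: "S \<subseteq> D" "D \<subseteq> carrier G" and index: "finite (rcosets\<^bsub>G\<lparr>carrier := D\<rparr>\<^esub> S)"
    and D: "subgroup D G" and S': "subgroup S G"
    and x: "x \<in> H" and fin: "finite ((\<lambda>s. \<pi> s x) ` S)"
  shows "finite ((\<lambda>d. \<pi> d x) ` D)"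
proof -
  define r where "r Q = (SOME d. d \<in> D \<and> Q = S #> d)" for Q
  have "\<pi> d x \<in> (\<Union>Q\<in>rcosets\<^bsub>G\<lparr>carrier := D\<rparr>\<^esub> S. \<pi> (inv (r Q)) ` (\<lambda>s. \<pi> s x) ` S)" if d: "d \<in> D" for d
  proof -
    define Q where "Q = S #> inv d"
    have dG: "d \<in> carrier G" and idD: "inv d \<in> D" using d S(2) subgroup.m_inv_closed[OF D] by blast+
    have Q: "Q \<in> rcosets\<^bsub>G\<lparr>carrier := D\<rparr>\<^esub> S"
      unfolding Q_def RCOSETS_def r_coset_def using idD by auto
    have "r Q \<in> D \<and> Q = S #> r Q"
      using someI[of "\<lambda>d. d \<in> D \<and> Q = S #> d" "inv d"] idD Q_def unfolding r_def by blast
    then have rD: "r Q \<in> D" and rQ: "Q = S #> r Q" by blast+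
    have rG: "r Q \<in> carrier G" using rD S(2) by blast
    have "inv d \<in> Q" unfolding Q_def by (rule rcos_self[OF inv_closed[OF dG] S'])
    then have "inv d \<in> S #> r Q" by (rule subsetD[OF equalityD1[OF rQ]])
    then obtain s where s: "s \<in> S" "inv d = s \<otimes> r Q" unfolding r_coset_def by blast
    have sG: "s \<in> carrier G" using s(1) S by blast
    have "d = inv (r Q) \<otimes> inv s" using arg_cong[OF s(2), of "\<lambda>y. inv y"] dG sG rG by (simp add: inv_mult_group)
    then have "\<pi> d x = \<pi> (inv (r Q)) (\<pi> (inv s) x)" using sG rG x by (simp add: rep_mult)
    moreover have "inv s \<in> S" by (rule subgroup.m_inv_closed[OF S' s(1)])
    ultimately show ?thesis using Q by blast
  qed
  then have "(\<lambda>d. \<pi> d x) ` D \<subseteq> (\<Union>Q\<in>rcosets\<^bsub>G\<lparr>carrier := D\<rparr>\<^esub> S. \<pi> (inv (r Q)) ` (\<lambda>s. \<pi> s x) ` S)"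
    by (rule image_subsetI)
  then show ?thesis by (rule finite_subset[OF _ finite_UN_I[OF index finite_imageI[OF fin]]])
qed


subsection \<open>Algebraic points of an orbit\<close>

text \<open>
  The analogue, inside the orbit of \<open>x\<close>, of the algebraic closure in model theory: the points with
  finitely many conjugates over \<open>x\<close>.
\<close>

definition acl :: "'h \<Rightarrow> 'h set"
  where "acl x = {y \<in> orb x. finite ((\<lambda>u. \<pi> u y) ` isotropy x)}"

lemma orb_rep: "x \<in> H \<Longrightarrow> g \<in> carrier G \<Longrightarrow> orb (\<pi> g x) = orb x"
proof -
  assume x: "x \<in> H" and g: "g \<in> carrier G"
  have "orb (\<pi> g x) \<subseteq> orb x"
    unfolding orb_def using x g rep_mult[symmetric] by (auto intro!: imageI)
  moreover have "orb x \<subseteq> orb (\<pi> g x)"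
  proof
    fix y assume "y \<in> orb x"
    then obtain h where h: "h \<in> carrier G" "y = \<pi> h x" unfolding orb_def by blast
    then have "y = \<pi> (h \<otimes> inv g) (\<pi> g x)" using x g by (simp add: rep_mult rep_closed rep_inv)
    then show "y \<in> orb (\<pi> g x)" unfolding orb_def using h g by blast
  qed
  ultimately show ?thesis by blast
qed

lemma acl_subset: "x \<in> H \<Longrightarrow> acl x \<subseteq> H"
  using orb_subset unfolding acl_def by blast

lemma mem_acl_self: "x \<in> H \<Longrightarrow> x \<in> acl x"
proof -
  assume x: "x \<in> H"
  have "(\<lambda>u. \<pi> u x) ` isotropy x \<subseteq> {x}" by (auto simp: isotropy_def)
  then show ?thesis unfolding acl_def using mem_orb_self[OF x] by (simp add: finite_subset)
qed

lemma acl_rep_subset: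
  assumes x: "x \<in> H" and g: "g \<in> carrier G"
  shows "\<pi> g ` acl x \<subseteq> acl (\<pi> g x)"
proof (rule image_subsetI)
  fix y assume y: "y \<in> acl x"
  then have yH: "y \<in> H" using acl_subset[OF x] by blast
  have "(\<lambda>u. \<pi> u (\<pi> g y)) ` isotropy (\<pi> g x) \<subseteq> \<pi> g ` (\<lambda>u. \<pi> u y) ` isotropy x"
  proof (rule image_subsetI)
    fix u assume "u \<in> isotropy (\<pi> g x)"
    then have u: "u \<in> carrier G" "\<pi> u (\<pi> g x) = \<pi> g x" by (auto simp: isotropy_def)
    let ?k = "inv g \<otimes> u \<otimes> g"
    have "\<pi> ?k x = x" using u x g by (simp add: rep_mult rep_closed rep_inv)
    then have "?k \<in> isotropy x" using u g by (simp add: isotropy_def)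
    moreover have "\<pi> u (\<pi> g y) = \<pi> g (\<pi> ?k y)" using u yH g by (simp add: rep_mult rep_closed rep_inv')
    ultimately show "\<pi> u (\<pi> g y) \<in> \<pi> g ` (\<lambda>u. \<pi> u y) ` isotropy x" by blast
  qed
  then have "finite ((\<lambda>u. \<pi> u (\<pi> g y)) ` isotropy (\<pi> g x))"
    by (rule finite_subset) (use y in \<open>simp add: acl_def\<close>)
  moreover have "\<pi> g y \<in> orb (\<pi> g x)"
    unfolding orb_rep[OF x g] using y g x by (intro rep_orb) (auto simp: acl_def)
  ultimately show "\<pi> g y \<in> acl (\<pi> g x)" unfolding acl_def by simp
qed

lemma acl_rep:
  assumes x: "x \<in> H" and g: "g \<in> carrier G"
  shows "acl (\<pi> g x) = \<pi> g ` acl x"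
proof
  show "acl (\<pi> g x) \<subseteq> \<pi> g ` acl x"
  proof
    fix y assume y: "y \<in> acl (\<pi> g x)"
    have yH: "y \<in> H" using y acl_subset[OF rep_closed[OF g x]] by blast
    have "\<pi> (inv g) y \<in> acl (\<pi> (inv g) (\<pi> g x))"
      using acl_rep_subset[OF rep_closed[OF g x] inv_closed[OF g]] y by blast
    then have "\<pi> (inv g) y \<in> acl x" using rep_inv[OF g x] by simp
    then have "\<pi> g (\<pi> (inv g) y) \<in> \<pi> g ` acl x" by (rule imageI)
    then show "y \<in> \<pi> g ` acl x" using rep_inv'[OF g yH] by simp
  qed
qed (rule acl_rep_subset[OF x g])

text \<open>
  The conjugates of \<open>z\<close> over \<open>x\<close> are obtained by choosing one of the finitely many conjugates \<open>y'\<close> of \<open>y\<close>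
  and then moving one of the finitely many conjugates of \<open>z\<close> over \<open>y\<close> along with it.
\<close>

lemma acl_trans:
  assumes x: "x \<in> H" and y: "y \<in> acl x"
  shows "acl y \<subseteq> acl x"
proof
  fix z assume z: "z \<in> acl y"
  obtain g where g: "g \<in> carrier G" "y = \<pi> g x" using y unfolding acl_def orb_def by blast
  have yH: "y \<in> H" using y acl_subset[OF x] by blast
  have zH: "z \<in> H" using z acl_subset[OF yH] by blast
  have orb: "orb y = orb x" unfolding g(2) by (rule orb_rep[OF x g(1)])
  \<comment> \<open>an element that carries \<open>y\<close> to its conjugate \<open>y'\<close>\<close>
  define c where "c y' = (SOME h. h \<in> isotropy x \<and> \<pi> h y = y')" for y'
  have "(\<lambda>u. \<pi> u z) ` isotropy x \<subseteq> (\<Union>y'\<in>(\<lambda>u. \<pi> u y) ` isotropy x. \<pi> (c y') ` (\<lambda>k. \<pi> k z) ` isotropy y)"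
  proof (rule image_subsetI)
    fix u assume u: "u \<in> isotropy x"
    let ?h = "c (\<pi> u y)"
    have h: "?h \<in> isotropy x" "\<pi> ?h y = \<pi> u y"
      using someI[of "\<lambda>h. h \<in> isotropy x \<and> \<pi> h y = \<pi> u y" u] u unfolding c_def by blast+
    have uG: "u \<in> carrier G" "?h \<in> carrier G" using u h(1) by (auto simp: isotropy_def)
    have "\<pi> (inv ?h \<otimes> u) y = \<pi> (inv ?h) (\<pi> ?h y)" using uG yH h(2) by (simp add: rep_mult)
    then have "inv ?h \<otimes> u \<in> isotropy y" using uG yH by (simp add: isotropy_def rep_inv)
    moreover have "\<pi> u z = \<pi> ?h (\<pi> (inv ?h \<otimes> u) z)" using uG zH by (simp add: rep_mult rep_closed rep_inv')
    ultimately show "\<pi> u z \<in> (\<Union>y'\<in>(\<lambda>u. \<pi> u y) ` isotropy x. \<pi> (c y') ` (\<lambda>k. \<pi> k z) ` isotropy y)"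
      using u by blast
  qed
  moreover have "finite (\<Union>y'\<in>(\<lambda>u. \<pi> u y) ` isotropy x. \<pi> (c y') ` (\<lambda>k. \<pi> k z) ` isotropy y)"
    using y z unfolding acl_def by (intro finite_UN_I finite_imageI[where h = "\<pi> _"]) simp_all
  ultimately have "finite ((\<lambda>u. \<pi> u z) ` isotropy x)" by (rule finite_subset)
  then show "z \<in> acl x" using z orb unfolding acl_def by simp
qed

text \<open>
  The stabilizer of \<open>x\<close> has one orbit on the translates of \<open>x\<close> for each of its double cosets, and \<open>acl x\<close>
  is the union of those of these finitely many orbits that are finite.
\<close>

lemma finite_acl:
  assumes x: "x \<in> H" and fin: "finite (coefficients x)"
  shows "finite (acl x)"
proof -
  let ?U = "isotropy x"
  have U: "subgroup ?U G" "openin T ?U" by (rule subgroup_isotropy[OF x], rule openin_isotropy[OF x fin])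
  obtain F where F: "finite F" "F \<subseteq> carrier G"
      "\<forall>g\<in>carrier G. \<exists>v\<in>?U. \<exists>f\<in>F. \<exists>w\<in>?U. g = v \<otimes> f \<otimes> w"
    using finite_double_cosets[OF U] by blast
  define F' where "F' = {f \<in> F. finite ((\<lambda>u. \<pi> u (\<pi> f x)) ` ?U)}"
  have "acl x \<subseteq> (\<Union>f\<in>F'. (\<lambda>u. \<pi> u (\<pi> f x)) ` ?U)"
  proof
    fix y assume y: "y \<in> acl x"
    then obtain g where g: "g \<in> carrier G" "y = \<pi> g x" unfolding acl_def orb_def by blast
    then obtain v f w where vfw: "v \<in> ?U" "f \<in> F" "w \<in> ?U" "g = v \<otimes> f \<otimes> w" using F(3) by blast
    have vG: "v \<in> carrier G" "f \<in> carrier G" "w \<in> carrier G" and wx: "\<pi> w x = x"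
      using vfw F(2) by (auto simp: isotropy_def)
    have yf: "y = \<pi> v (\<pi> f x)" unfolding g(2) vfw(4) using vG x by (simp add: rep_mult rep_closed wx)
    have "\<pi> u (\<pi> f x) \<in> (\<lambda>u. \<pi> u y) ` ?U" if u: "u \<in> ?U" for u
    proof -
      have uG: "u \<in> carrier G" using u by (simp add: isotropy_def)
      have "\<pi> (u \<otimes> inv v) y = \<pi> u (\<pi> f x)"
        unfolding yf using uG vG x by (simp add: rep_mult rep_closed rep_inv)
      moreover have "u \<otimes> inv v \<in> ?U"
        by (intro subgroup.m_closed[OF U(1)] subgroup.m_inv_closed[OF U(1)] u vfw)
      ultimately show ?thesis by (metis image_eqI)
    qed
    then have "(\<lambda>u. \<pi> u (\<pi> f x)) ` ?U \<subseteq> (\<lambda>u. \<pi> u y) ` ?U" by (rule image_subsetI)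
    then have "finite ((\<lambda>u. \<pi> u (\<pi> f x)) ` ?U)"
      by (rule finite_subset) (use y in \<open>simp add: acl_def\<close>)
    then show "y \<in> (\<Union>f\<in>F'. (\<lambda>u. \<pi> u (\<pi> f x)) ` ?U)" unfolding F'_def yf using vfw by blast
  qed
  moreover have "finite (\<Union>f\<in>F'. (\<lambda>u. \<pi> u (\<pi> f x)) ` ?U)" using F(1) unfolding F'_def by auto
  ultimately show ?thesis by (rule finite_subset)
qed

text \<open>
  By transitivity the translate is contained in \<open>acl x\<close>; both are finite of the same size.
\<close>

lemma acl_eq:
  assumes x: "x \<in> H" and fin: "finite (coefficients x)" and g: "g \<in> carrier G" and y: "\<pi> g x \<in> acl x"
  shows "\<pi> g ` acl x = acl x"
proof (rule endo_inj_surj)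
  show "finite (acl x)" by (rule finite_acl[OF x fin])
  show "\<pi> g ` acl x \<subseteq> acl x" using acl_trans[OF x y] unfolding acl_rep[OF x g] .
  show "inj_on (\<pi> g) (acl x)"
    by (rule inj_on_inverseI[where g = "\<pi> (inv g)"]) (use acl_subset[OF x] rep_inv[OF g] in blast)
qed


subsection \<open>Vectors of minimal norm with prescribed coefficients\<close>

text \<open>
  The norms of nonzero vectors with all coefficients in a given finite set \<open>F\<close> take finitely many
  values, so there is such a vector of least norm. A non-orthogonal translate with infinitely many
  conjugates would have a weak limit of conjugates that is shorter, nonzero, and still has all its
  coefficients in \<open>F\<close>.
\<close>

lemma ex_minimal_vector:
  assumes "H \<noteq> {0}"
  shows "\<exists>\<eta>\<in>H. \<eta> \<noteq> 0 \<and> finite (coefficients \<eta>) \<and>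
    (\<forall>x\<in>orb \<eta>. x \<notin> acl \<eta> \<longrightarrow> cinner x \<eta> = 0)"
proof -
  obtain V \<xi> where V: "subgroup V G" "openin T V" and \<xi>: "\<xi> \<in> fixed V" "\<xi> \<noteq> 0"
    using ex_fixed_vector[OF assms] by blast
  define F where "F = coefficients \<xi>"
  have fin: "finite F" unfolding F_def by (rule finite_coefficients_fixed[OF V \<xi>(1)])
  define Y where "Y = {y \<in> H. y \<noteq> 0 \<and> coefficients y \<subseteq> F}"
  have \<xi>Y: "\<xi> \<in> Y" using \<xi> by (simp add: Y_def F_def fixed_def)
  have "norm y \<in> (\<lambda>c. sqrt (Re c)) ` F" if "y \<in> Y" for y
    using that norm_in_coefficients[of y] unfolding Y_def
    by (intro image_eqI[where x = "of_real ((norm y)\<^sup>2)"]) auto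
  then have "norm ` Y \<subseteq> (\<lambda>c. sqrt (Re c)) ` F" by (rule image_subsetI)
  then have "finite (norm ` Y)" by (rule finite_subset[OF _ finite_imageI[OF fin]])
  then obtain \<eta> where \<eta>: "\<eta> \<in> Y" and min: "\<And>y. y \<in> Y \<Longrightarrow> norm \<eta> \<le> norm y"
    using \<xi>Y ex_min_if_finite[of "norm ` Y"] by (metis empty_iff image_iff not_less)
  have \<eta>H: "\<eta> \<in> H" and \<eta>0: "\<eta> \<noteq> 0" and \<eta>F: "coefficients \<eta> \<subseteq> F" using \<eta> unfolding Y_def by blast+
  have "cinner y \<eta> = 0" if y: "y \<in> orb \<eta>" "y \<notin> acl \<eta>" for y
  proof (rule ccontr)
    assume c: "cinner y \<eta> \<noteq> 0"
    define Z where "Z = (\<lambda>u. \<pi> u y) ` isotropy \<eta>"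
    have infZ: "infinite Z" using y unfolding Z_def acl_def by blast
    have yH: "y \<in> H" using y(1) orb_subset[OF \<eta>H] by blast
    have Zorb: "z \<in> orb \<eta>" if "z \<in> Z" for z
      using that y(1) rep_orb[OF \<eta>H] by (auto simp: Z_def isotropy_def)
    then have ZH: "z \<in> H" if "z \<in> Z" for z using that orb_subset[OF \<eta>H] by blast
    have Z\<eta>: "cinner z \<eta> = cinner y \<eta>" if "z \<in> Z" for z
    proof -
      from that obtain u where "u \<in> isotropy \<eta>" "z = \<pi> u y" unfolding Z_def by (elim imageE)
      then have u: "u \<in> carrier G" "\<pi> u \<eta> = \<eta>" "z = \<pi> u y" by (simp_all add: isotropy_def)
      then have "cinner z \<eta> = cinner (\<pi> u y) (\<pi> u \<eta>)" by simp
      also have "\<dots> = cinner y \<eta>" by (rule rep_cinner[OF u(1) yH \<eta>H])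
      finally show ?thesis .
    qed
    have ZF: "cinner (\<pi> h z) z' \<in> F" if z: "z \<in> Z" "z' \<in> Z" and h: "h \<in> carrier G" for z z' h
    proof -
      have "\<pi> h z \<in> orb \<eta>" by (rule rep_orb[OF \<eta>H h Zorb[OF z(1)]])
      then obtain a where a: "a \<in> carrier G" "\<pi> h z = \<pi> a \<eta>" unfolding orb_def by blast
      obtain b where b: "b \<in> carrier G" "z' = \<pi> b \<eta>" using Zorb[OF z(2)] unfolding orb_def by blast
      show ?thesis unfolding a(2) b(2) using cinner_orbit_in_coefficients[OF \<eta>H a(1) b(1)] \<eta>F by blast
    qed
    have normZ: "norm z = norm \<eta>" if "z \<in> Z" for z
      using Zorb[OF that] norm_rep[OF _ \<eta>H] by (auto simp: orb_def)
    have "{x \<bullet> y | x y. x \<in> Z \<and> y \<in> Z} \<subseteq> Re ` F"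
    proof (rule subsetI, elim CollectE exE conjE)
      fix v x y assume xy: "v = x \<bullet> y" "x \<in> Z" "y \<in> Z"
      have "cinner x y \<in> F" using ZF[OF xy(2,3) one_closed] rep_one[OF ZH[OF xy(2)]] by simp
      then show "v \<in> Re ` F" unfolding xy(1) Re_cinner[symmetric] by (rule imageI)
    qed
    then have "finite {x \<bullet> y | x y. x \<in> Z \<and> y \<in> Z}" by (rule finite_subset[OF _ finite_imageI[OF fin]])
    from ex_weak_limit_of_smaller_norm[OF infZ normZ this] obtain x \<zeta>
      where x: "\<And>n::nat. x n \<in> Z" and weak: "\<And>z. (\<lambda>n. x n \<bullet> z) \<longlonglongrightarrow> \<zeta> \<bullet> z"
        and less: "norm \<zeta> < norm \<eta>" and \<zeta>: "\<zeta> \<in> closure (span Z)" by blast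
    have "closure (span Z) \<subseteq> H"
      using ZH H_closed(1) closed_csubspace_imp_subspace[OF csubspace]
      by (intro closure_minimal span_minimal) auto
    then have \<zeta>H: "\<zeta> \<in> H" using \<zeta> by blast
    have cweak: "(\<lambda>n. cinner (x n) z) \<longlonglongrightarrow> cinner \<zeta> z" for z
      unfolding cinner_eq_inner by (intro tendsto_Complex weak)
    have "cinner \<zeta> \<eta> = cinner y \<eta>" using cweak[of \<eta>] Z\<eta>[OF x] by (simp add: LIMSEQ_const_iff)
    then have "\<zeta> \<noteq> 0" using c by auto
    moreover have "coefficients \<zeta> \<subseteq> F"
      unfolding coefficients_def
    proof (rule image_subsetI)
      fix h assume h: "h \<in> carrier G"
      \<comment> \<open>passing to the weak limit in one argument at a time stays in the closed set \<open>F\<close>\<close>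
      have closed: "closed F" by (rule finite_imp_closed[OF fin])
      have one: "cinner (\<pi> h \<zeta>) (x m) \<in> F" for m
      proof (rule closed_sequentially[OF closed])
        have xH: "x n \<in> H" for n by (rule ZH[OF x])
        show "cinner (\<pi> h (x n)) (x m) \<in> F" for n by (rule ZF[OF x x h])
        show "(\<lambda>n. cinner (\<pi> h (x n)) (x m)) \<longlonglongrightarrow> cinner (\<pi> h \<zeta>) (x m)"
          unfolding cinner_rep_left[OF h xH xH] cinner_rep_left[OF h \<zeta>H xH] by (rule cweak)
      qed
      show "cinner (\<pi> h \<zeta>) \<zeta> \<in> F"
      proof (rule closed_sequentially[OF closed one])
        have "(\<lambda>m. cnj (cinner (x m) (\<pi> h \<zeta>))) \<longlonglongrightarrow> cnj (cinner \<zeta> (\<pi> h \<zeta>))"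
          by (intro tendsto_cnj cweak)
        then show "(\<lambda>m. cinner (\<pi> h \<zeta>) (x m)) \<longlonglongrightarrow> cinner (\<pi> h \<zeta>) \<zeta>"
          by (simp only: cinner_commute[symmetric])
      qed
    qed
    ultimately have "\<zeta> \<in> Y" using \<zeta>H unfolding Y_def by blast
    then show False using min less by fastforce
  qed
  then show ?thesis using \<eta>H \<eta>0 finite_subset[OF \<eta>F fin] by blast
qed

end


section \<open>The inducing subgroup and its finite quotient\<close>

text \<open>
  The sets \<open>acl (g \<eta>)\<close> partition the orbit of \<open>\<eta>\<close> into finite blocks that are mutually orthogonal. The
  group \<open>C\<close> below is the stabilizer of the block of \<open>\<eta>\<close> and \<open>V\<close> is the kernel of its action on the
  block; the span \<open>K\<close> of the block is the space of the inducing representation.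
\<close>

locale minimal_vector = unitary_representation G T H \<pi>
  for G (structure) and T and H :: "'h::complex_hilbert_space set" and \<pi> +
  fixes \<eta> :: 'h
  assumes vector: "\<eta> \<in> H" "\<eta> \<noteq> 0" and finite_coefficients: "finite (coefficients \<eta>)"
    and orthogonal: "x \<in> orb \<eta> \<Longrightarrow> x \<notin> acl \<eta> \<Longrightarrow> cinner x \<eta> = 0"
begin

definition C :: "'a set"
  where "C = {g \<in> carrier G. \<pi> g ` acl \<eta> = acl \<eta>}"

definition V :: "'a set"
  where "V = {g \<in> carrier G. \<forall>a\<in>acl \<eta>. \<pi> g a = a}"

definition K :: "'h set"
  where "K = closed_chull (acl \<eta>)"

lemma acl_H: "a \<in> acl \<eta> \<Longrightarrow> a \<in> H"
  using acl_subset[OF vector(1)] by blast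

lemma C_iff: "g \<in> carrier G \<Longrightarrow> g \<in> C \<longleftrightarrow> \<pi> g \<eta> \<in> acl \<eta>"
  using acl_eq[OF vector(1) finite_coefficients, of g] mem_acl_self[OF vector(1)]
  unfolding C_def by blast

lemma subgroup_C: "subgroup C G"
proof (rule subgroupI)
  show "C \<subseteq> carrier G" by (auto simp: C_def)
  have "\<one> \<in> C" using C_iff[OF one_closed] mem_acl_self[OF vector(1)] rep_one[OF vector(1)] by simp
  then show "C \<noteq> {}" by blast
  fix g assume "g \<in> C"
  then have g: "g \<in> carrier G" "\<pi> g ` acl \<eta> = acl \<eta>" by (auto simp: C_def)
  have "\<pi> (inv g) ` acl \<eta> = \<pi> (inv g) ` \<pi> g ` acl \<eta>" by (simp only: g(2))
  also have "\<dots> = (\<lambda>a. a) ` acl \<eta>"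
    unfolding image_image by (rule image_cong[OF refl]) (rule rep_inv[OF g(1) acl_H])
  finally show "inv g \<in> C" using g(1) by (simp add: C_def)
  fix h assume "h \<in> C"
  then have h: "h \<in> carrier G" "\<pi> h ` acl \<eta> = acl \<eta>" by (auto simp: C_def)
  have "\<pi> (g \<otimes> h) ` acl \<eta> = \<pi> g ` \<pi> h ` acl \<eta>"
    unfolding image_image by (rule image_cong[OF refl]) (rule rep_mult[OF g(1) h(1) acl_H])
  then show "g \<otimes> h \<in> C" using g h by (simp add: C_def)
qed

lemma C_carrier: "g \<in> C \<Longrightarrow> g \<in> carrier G"
  using subgroup.subset[OF subgroup_C] by blast

lemma rep_acl: "g \<in> C \<Longrightarrow> a \<in> acl \<eta> \<Longrightarrow> \<pi> g a \<in> acl \<eta>"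
  unfolding C_def by blast

lemma subgroup_V: "subgroup V G"
proof (rule subgroupI)
  show "V \<subseteq> carrier G" by (auto simp: V_def)
  have "\<one> \<in> V" using rep_one[OF acl_H] by (simp add: V_def)
  then show "V \<noteq> {}" by blast
  fix g assume "g \<in> V"
  then have g: "g \<in> carrier G" "\<And>a. a \<in> acl \<eta> \<Longrightarrow> \<pi> g a = a" by (auto simp: V_def)
  have "\<pi> (inv g) a = a" if a: "a \<in> acl \<eta>" for a
    using rep_inv[OF g(1) acl_H[OF a]] g(2)[OF a] by simp
  then show "inv g \<in> V" using g(1) by (simp add: V_def)
  show "g \<otimes> h \<in> V" if "h \<in> V" for h
    using that g rep_mult[OF g(1) _ acl_H] by (simp add: V_def)
qed

lemma V_subset_C: "V \<subseteq> C"
  using C_iff mem_acl_self[OF vector(1)] by (auto simp: V_def)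

lemma isotropy_subset_C: "isotropy \<eta> \<subseteq> C"
  using C_iff mem_acl_self[OF vector(1)] by (auto simp: isotropy_def)

text \<open>
  The group \<open>V\<close> is the intersection of the stabilizers of finitely many translates of \<open>\<eta>\<close>, whose
  coefficients are among those of \<open>\<eta>\<close>.
\<close>

lemma openin_V: "openin T V"
proof -
  have "openin T (isotropy a)" if a: "a \<in> acl \<eta>" for a
  proof -
    obtain g where g: "g \<in> carrier G" "a = \<pi> g \<eta>" using a unfolding acl_def orb_def by blast
    have "coefficients a \<subseteq> coefficients \<eta>"
      unfolding coefficients_def[of a]
    proof (rule image_subsetI)
      fix h assume h: "h \<in> carrier G"
      have "cinner (\<pi> (h \<otimes> g) \<eta>) (\<pi> g \<eta>) \<in> coefficients \<eta>"
        by (intro cinner_orbit_in_coefficients vector m_closed h g)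
      then show "cinner (\<pi> h a) a \<in> coefficients \<eta>"
        unfolding g(2) using h g(1) by (simp add: rep_mult vector(1))
    qed
    then show ?thesis using openin_isotropy[OF acl_H[OF a]] finite_coefficients finite_subset by blast
  qed
  moreover have "V = (\<Inter>a\<in>acl \<eta>. isotropy a)"
    using mem_acl_self[OF vector(1)] unfolding V_def isotropy_def by blast
  ultimately show ?thesis
    using finite_acl[OF vector(1) finite_coefficients] mem_acl_self[OF vector(1)]
    by (auto intro!: openin_Inter)
qed

lemma conjugate_V:
  assumes g: "g \<in> C" and v: "v \<in> V"
  shows "g \<otimes> v \<otimes> inv g \<in> V"
proof -
  have gG: "g \<in> carrier G" "v \<in> carrier G" using C_carrier[OF g] v by (auto simp: V_def)
  have "\<pi> (g \<otimes> v \<otimes> inv g) a = a" if a: "a \<in> acl \<eta>" for a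
  proof -
    have "\<pi> (inv g) a \<in> acl \<eta>" by (rule rep_acl[OF subgroup.m_inv_closed[OF subgroup_C g] a])
    then have "\<pi> v (\<pi> (inv g) a) = \<pi> (inv g) a" using v by (simp add: V_def)
    then show ?thesis using gG acl_H[OF a] by (simp add: rep_mult rep_closed rep_inv')
  qed
  then show ?thesis using gG by (simp add: V_def)
qed

abbreviation GC :: "('a, 'b) monoid_scheme"
  where "GC \<equiv> G\<lparr>carrier := C\<rparr>"

lemma group_GC: "group GC"
  by (rule subgroup_imp_group[OF subgroup_C])

lemma normal_V: "V \<lhd> GC"
proof -
  have sub: "subgroup V GC" by (rule subgroup_incl[OF subgroup_V subgroup_C V_subset_C])
  have "x \<otimes>\<^bsub>GC\<^esub> v \<otimes>\<^bsub>GC\<^esub> inv\<^bsub>GC\<^esub> x \<in> V" if "x \<in> carrier GC" "v \<in> V" for x v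
    using conjugate_V that m_inv_consistent[OF subgroup_C] by simp
  then show ?thesis using group.normal_inv_iff[OF group_GC] sub by blast
qed

lemma coset_eqI:
  assumes g: "g \<in> C" and h: "h \<in> C" and eq: "\<And>a. a \<in> acl \<eta> \<Longrightarrow> \<pi> g a = \<pi> h a"
  shows "V #> g = V #> h"
proof -
  have gG: "g \<in> carrier G" "h \<in> carrier G" using g h C_carrier by blast+
  have "\<pi> (g \<otimes> inv h) a = a" if a: "a \<in> acl \<eta>" for a
  proof -
    have "\<pi> (inv h) a \<in> acl \<eta>" by (rule rep_acl[OF subgroup.m_inv_closed[OF subgroup_C h] a])
    then show ?thesis using eq gG acl_H[OF a] by (simp add: rep_mult rep_inv')
  qed
  then have v: "g \<otimes> inv h \<in> V" using gG by (simp add: V_def)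
  have "g = (g \<otimes> inv h) \<otimes> h" using gG by (simp add: m_assoc)
  then have "g \<in> V #> h" unfolding r_coset_def using v by blast
  then show ?thesis by (rule repr_independence[OF _ gG(2) subgroup_V, symmetric])
qed

lemma rcosets_GC: "rcosets\<^bsub>GC\<^esub> V = (\<lambda>g. V #> g) ` C"
  unfolding RCOSETS_def r_coset_def by auto

text \<open>
  A coset of \<open>V\<close> in \<open>C\<close> is determined by a map of the finite set \<open>acl \<eta>\<close> into itself.
\<close>

lemma finite_rcosets_V: "finite (rcosets\<^bsub>GC\<^esub> V)"
proof -
  define \<rho> where "\<rho> g = restrict (\<pi> g) (acl \<eta>)" for g
  define s where "s r = (SOME g. g \<in> C \<and> \<rho> g = r)" for r
  have "V #> g = V #> s (\<rho> g)" if g: "g \<in> C" for g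
  proof (rule coset_eqI[OF g])
    have s: "s (\<rho> g) \<in> C \<and> \<rho> (s (\<rho> g)) = \<rho> g"
      unfolding s_def by (rule someI[of "\<lambda>h. h \<in> C \<and> \<rho> h = \<rho> g" g]) (simp add: g)
    then show "s (\<rho> g) \<in> C" by blast
    show "\<pi> g a = \<pi> (s (\<rho> g)) a" if "a \<in> acl \<eta>" for a
      using fun_cong[OF conjunct2[OF s], of a] that by (simp add: \<rho>_def)
  qed
  moreover have "\<rho> g \<in> acl \<eta> \<rightarrow>\<^sub>E acl \<eta>" if "g \<in> C" for g
    using rep_acl[OF that] by (simp add: \<rho>_def)
  ultimately have "rcosets\<^bsub>GC\<^esub> V \<subseteq> (\<lambda>r. V #> s r) ` (acl \<eta> \<rightarrow>\<^sub>E acl \<eta>)"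
    unfolding rcosets_GC by blast
  moreover have "finite (acl \<eta> \<rightarrow>\<^sub>E acl \<eta>)"
    by (intro finite_PiE finite_acl vector finite_coefficients)
  ultimately show ?thesis by (rule finite_subset[OF _ finite_imageI])
qed

lemma conjugate_eq_V:
  assumes g: "g \<in> C"
  shows "g <# V #> inv g = V"
proof -
  have gG: "g \<in> carrier G" by (rule C_carrier[OF g])
  have eq: "g <# V #> inv g = (\<lambda>v. g \<otimes> v \<otimes> inv g) ` V"
    unfolding l_coset_def r_coset_def by blast
  have "v \<in> (\<lambda>v. g \<otimes> v \<otimes> inv g) ` V" if v: "v \<in> V" for v
  proof -
    have vG: "v \<in> carrier G" using v by (simp add: V_def)
    have "inv g \<otimes> v \<otimes> inv (inv g) \<in> V"
      by (rule conjugate_V[OF subgroup.m_inv_closed[OF subgroup_C g] v])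
    moreover have "v = g \<otimes> (inv g \<otimes> v \<otimes> inv (inv g)) \<otimes> inv g"
      using gG vG by (simp add: m_assoc) (simp add: m_assoc[symmetric])
    ultimately show ?thesis by blast
  qed
  then show ?thesis unfolding eq using conjugate_V[OF g] by blast
qed

text \<open>
  Normality of \<open>V\<close> gives one inclusion. Conversely, the conjugate of \<open>V\<close> by \<open>g\<close> fixes \<open>g \<eta>\<close>. If it meets
  \<open>V\<close> in a subgroup of finite index in \<open>V\<close>, then \<open>g \<eta>\<close> has a finite orbit under \<open>V\<close>, hence under \<open>C\<close>, in which
  \<open>V\<close> has finite index, and a fortiori under the stabilizer of \<open>\<eta>\<close>; so \<open>g \<eta>\<close> lies in the block of \<open>\<eta>\<close>.
\<close>

lemma commensurator_V: "commensurator G V = C"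
proof (intro equalityI subsetI)
  fix g assume g: "g \<in> C"
  have "V #> v = V" if "v \<in> V" for v
    by (rule coset_join2[OF _ subgroup_V that]) (use that in \<open>simp add: V_def\<close>)
  then have "rcosets\<^bsub>G\<lparr>carrier := V\<rparr>\<^esub> V \<subseteq> {V}" unfolding RCOSETS_def r_coset_def by auto
  then have "finite (rcosets\<^bsub>G\<lparr>carrier := V\<rparr>\<^esub> V)" by (rule finite_subset) simp
  then show "g \<in> commensurator G V"
    unfolding commensurator_def commensurate_def using C_carrier[OF g] by (simp add: conjugate_eq_V[OF g])
next
  fix g assume g: "g \<in> commensurator G V"
  define W where "W = g <# V #> inv g"
  have gG: "g \<in> carrier G" and index: "finite (rcosets\<^bsub>G\<lparr>carrier := V\<rparr>\<^esub> (V \<inter> W))"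
    using g unfolding commensurator_def commensurate_def W_def by blast+
  let ?x = "\<pi> g \<eta>"
  have xH: "?x \<in> H" by (rule rep_closed[OF gG vector(1)])
  have W_fix: "\<pi> w ?x = ?x" if "w \<in> W" for w
  proof -
    from that obtain v where v: "v \<in> V" "w = g \<otimes> v \<otimes> inv g"
      unfolding W_def l_coset_def r_coset_def by blast
    then have "v \<in> carrier G" "\<pi> v \<eta> = \<eta>" using mem_acl_self[OF vector(1)] by (auto simp: V_def)
    then show ?thesis unfolding v(2) using gG vector(1) by (simp add: rep_mult rep_closed rep_inv)
  qed
  have W: "subgroup W G" unfolding W_def by (rule subgroup_conjugation_is_surj2[OF gG subgroup_V])
  have "(\<lambda>s. \<pi> s ?x) ` (V \<inter> W) \<subseteq> {?x}" using W_fix by auto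
  then have "finite ((\<lambda>s. \<pi> s ?x) ` (V \<inter> W))" by (rule finite_subset) simp
  then have "finite ((\<lambda>v. \<pi> v ?x) ` V)"
    by (intro finite_orbit_of_finite_index[OF _ _ index subgroup_V _ xH]
        subgroups_Inter_pair subgroup_V W subgroup.subset[OF subgroup_V]) auto
  then have "finite ((\<lambda>v. \<pi> v ?x) ` C)"
    by (intro finite_orbit_of_finite_index[OF V_subset_C _ finite_rcosets_V subgroup_C subgroup_V xH]
        subgroup.subset[OF subgroup_C])
  then have "finite ((\<lambda>v. \<pi> v ?x) ` isotropy \<eta>)"
    by (rule finite_subset[OF image_mono[OF isotropy_subset_C]])
  then have "?x \<in> acl \<eta>" unfolding acl_def orb_def using gG by blast
  then show "g \<in> C" using C_iff[OF gG] by blast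
qed

lemma csubspace_K: "closed_csubspace K"
  unfolding K_def by (rule closed_csubspace_closed_chull)

lemma K_subset: "K \<subseteq> H"
  unfolding K_def by (intro closed_chull_minimal csubspace acl_subset vector)

lemma vector_in_K: "\<eta> \<in> K"
  unfolding K_def using mem_acl_self[OF vector(1)] subset_closed_chull by blast

lemma rep_K: "g \<in> C \<Longrightarrow> x \<in> K \<Longrightarrow> \<pi> g x \<in> K"
  unfolding K_def
  by (rule rep_closed_chull[OF C_carrier acl_subset[OF vector(1)] subsetD[OF subset_closed_chull rep_acl]])

lemma V_fixes_K: "v \<in> V \<Longrightarrow> x \<in> K \<Longrightarrow> \<pi> v x = x"
proof -
  assume v: "v \<in> V" and x: "x \<in> K"
  then have vG: "v \<in> carrier G" by (simp add: V_def)
  have "K \<subseteq> {x \<in> H. \<pi> v x = x}"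
    unfolding K_def using v acl_H
    by (intro closed_chull_minimal closed_csubspace_fixed_by vG) (auto simp: V_def)
  then show ?thesis using x by blast
qed

text \<open>
  For generators \<open>c \<eta>\<close> and \<open>d \<eta>\<close> of \<open>K\<close> with \<open>c\<close> and \<open>d\<close> in \<open>C\<close>, the element \<open>d\<inverse> g c\<close> is outside \<open>C\<close> as
  well, so it moves \<open>\<eta>\<close> to a point outside \<open>acl \<eta>\<close>.
\<close>

lemma translates_orthogonal:
  assumes g: "g \<in> carrier G" "g \<notin> C" and x: "x \<in> K" and y: "y \<in> K"
  shows "cinner (\<pi> g x) y = 0"
proof -
  have "\<pi> g x \<in> closed_chull (\<pi> g ` acl \<eta>)"
    by (rule rep_closed_chull[OF g(1) acl_subset[OF vector(1)] _ x[unfolded K_def]])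
      (rule subsetD[OF subset_closed_chull imageI])
  moreover have "cinner s t = 0" if s: "s \<in> \<pi> g ` acl \<eta>" and t: "t \<in> acl \<eta>" for s t
  proof -
    obtain a where a: "a \<in> acl \<eta>" "s = \<pi> g a" using s by blast
    obtain c where c: "c \<in> carrier G" "a = \<pi> c \<eta>" using a(1) unfolding acl_def orb_def by blast
    obtain d where d: "d \<in> carrier G" "t = \<pi> d \<eta>" using t unfolding acl_def orb_def by blast
    have cd: "c \<in> C" "d \<in> C" using a(1) t c d C_iff by auto
    define k where "k = inv d \<otimes> g \<otimes> c"
    have kG: "k \<in> carrier G" unfolding k_def using c d g by simp
    have "g = d \<otimes> k \<otimes> inv c"
      unfolding k_def using c(1) d(1) g(1) by (simp add: m_assoc) (simp add: m_assoc[symmetric])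
    then have "k \<notin> C" using g(2) cd subgroup.m_closed[OF subgroup_C] subgroup.m_inv_closed[OF subgroup_C] by metis
    then have "cinner (\<pi> k \<eta>) \<eta> = 0"
      using orthogonal[of "\<pi> k \<eta>"] C_iff[OF kG] kG unfolding orb_def by blast
    moreover have "cinner s t = cinner (\<pi> (inv d) s) \<eta>"
      unfolding d(2) a(2) c(2) using c d g vector(1) cinner_rep_left[of "inv d" "\<pi> g (\<pi> c \<eta>)" \<eta>]
      by (simp add: rep_closed)
    moreover have "\<pi> (inv d) s = \<pi> k \<eta>"
      unfolding a(2) c(2) k_def using c d g vector(1) by (simp add: rep_mult rep_closed)
    ultimately show ?thesis by simp
  qed
  ultimately show ?thesis using orthogonal_closed_chull y unfolding K_def by blast
qed

end


section \<open>Irreducible representations are induced\<close>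

locale irreducible_minimal_vector = minimal_vector +
  assumes irreducible: "irreducible_unitary_rep G T H \<pi>"
begin

lemma orb_total:
  assumes k: "k \<in> H" "k \<noteq> 0" and x: "x \<in> H" and orth: "\<And>g. g \<in> carrier G \<Longrightarrow> cinner x (\<pi> g k) = 0"
  shows "x = 0"
proof -
  let ?N = "closed_chull (orb k)"
  have N: "invariant ?N" by (rule invariant_cyclic[OF k(1)])
  have "k \<in> ?N" by (rule subsetD[OF subset_closed_chull mem_orb_self[OF k(1)]])
  then have "?N \<noteq> {0}" using k(2) by blast
  then have "?N = H"
    using irreducible invariantD(1,2)[OF N] N
    unfolding irreducible_unitary_rep_def invariant_def by metis
  moreover have "?N \<subseteq> {z. \<forall>y\<in>{x}. cinner z y = 0}"
    using orth cinner_eq_zero_sym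
    by (intro closed_chull_minimal closed_csubspace_orthogonal) (auto simp: orb_def)
  ultimately have "cinner x x = 0" using x by blast
  then show ?thesis by (simp add: cinner_eq_zero_iff)
qed


subsection \<open>The representation of the finite quotient\<close>

text \<open>
  The choice of a representative \<open>h\<close> of the coset is immaterial on \<open>K\<close>, which \<open>V\<close> fixes pointwise.
\<close>

definition \<sigma> :: "'a set \<Rightarrow> 'c \<Rightarrow> 'c"
  where "\<sigma> Q x = \<pi> (SOME h. h \<in> Q) x"

lemma \<sigma>_coset:
  assumes h: "h \<in> C" and x: "x \<in> K"
  shows "\<sigma> (V #> h) x = \<pi> h x"
proof -
  have hG: "h \<in> carrier G" by (rule C_carrier[OF h])
  have "(SOME g. g \<in> V #> h) \<in> V #> h" by (rule someI[of "\<lambda>g. g \<in> V #> h", OF rcos_self[OF hG subgroup_V]])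
  then obtain v where v: "v \<in> V" "(SOME g. g \<in> V #> h) = v \<otimes> h" unfolding r_coset_def by blast
  then have vG: "v \<in> carrier G" by (simp add: V_def)
  have "\<pi> (v \<otimes> h) x = \<pi> v (\<pi> h x)" using x K_subset by (intro rep_mult vG hG) blast
  also have "\<dots> = \<pi> h x" by (rule V_fixes_K[OF v(1) rep_K[OF h x]])
  finally show ?thesis unfolding \<sigma>_def v(2) .
qed

text \<open>
  A vector of \<open>K\<close> orthogonal to a nonzero \<open>C\<close>-invariant subspace \<open>M\<close> of \<open>K\<close> is orthogonal to all translates
  of \<open>M\<close>, as the elements outside \<open>C\<close> move \<open>M\<close> into the orthogonal complement of \<open>K\<close>. These translates
  span \<open>H\<close>.
\<close>

lemma irreducible_K:
  assumes M: "closed_csubspace M" "M \<subseteq> K" and inv: "\<And>h x. h \<in> C \<Longrightarrow> x \<in> M \<Longrightarrow> \<pi> h x \<in> M"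
  shows "M = {0} \<or> M = K"
proof (rule ccontr)
  assume neg: "\<not> (M = {0} \<or> M = K)"
  obtain m where m: "m \<in> M" "m \<noteq> 0" using neg closed_csubspaceD(2)[OF M(1)] by blast
  obtain k where k: "k \<in> K" "k \<notin> M" using neg M(2) by blast
  define x where "x = k - proj M k"
  have p: "proj M k \<in> M" by (rule proj_in[OF M(1)])
  have xK: "x \<in> K" unfolding x_def using k p M(2) by (intro closed_csubspaceD(5)[OF csubspace_K]) auto
  have "x = 0"
  proof (rule orb_total[OF _ m(2)])
    show "m \<in> H" "x \<in> H" using m M(2) xK K_subset by blast+
    fix g assume g: "g \<in> carrier G"
    show "cinner x (\<pi> g m) = 0"
    proof (cases "g \<in> C")
      case True
      show ?thesis unfolding x_def by (rule proj_orthogonal[OF M(1) inv[OF True m(1)]])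
    next
      case False
      have "cinner (\<pi> g m) x = 0" using m(1) M(2) xK by (intro translates_orthogonal[OF g False]) auto
      then show ?thesis by (rule cinner_eq_zero_sym[THEN iffD1])
    qed
  qed
  then have "k = proj M k" by (simp add: x_def)
  then show False using p k(2) by metis
qed

lemma carrier_Mod: "carrier (GC Mod V) = (\<lambda>g. V #> g) ` C"
  unfolding FactGroup_def using rcosets_GC by simp

lemma Mod_mult:
  assumes "g \<in> C" "h \<in> C"
  shows "(V #> g) \<otimes>\<^bsub>GC Mod V\<^esub> (V #> h) = V #> (g \<otimes> h)"
  using normal.rcos_sum[OF normal_V, of g h] assms
  unfolding FactGroup_def r_coset_def set_mult_def by simp

lemma Mod_one: "\<one>\<^bsub>GC Mod V\<^esub> = V #> \<one>"
  unfolding FactGroup_def using coset_mult_one[OF subgroup.subset[OF subgroup_V]] by simp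

lemma irreducible_\<sigma>:
  "irreducible_unitary_rep (GC Mod V) (discrete_topology (carrier (GC Mod V))) K \<sigma>"
proof -
  let ?Q = "GC Mod V"
  have KH: "x \<in> H" if "x \<in> K" for x using that K_subset by blast
  have C1: "\<one> \<in> C" by (rule subgroup.one_closed[OF subgroup_C])
  have "unitary_rep ?Q (discrete_topology (carrier ?Q)) K \<sigma>"
    unfolding unitary_rep_def carrier_Mod
  proof (intro conjI ballI allI)
    show "closed_csubspace K" by (rule csubspace_K)
  next
    fix q x assume "q \<in> (\<lambda>g. V #> g) ` C" and x: "x \<in> K"
    then obtain g where g: "g \<in> C" "q = V #> g" by blast
    show "\<sigma> q x \<in> K" unfolding g(2) \<sigma>_coset[OF g(1) x] by (rule rep_K[OF g(1) x])
    show "\<sigma> q (c *\<^sub>C x) = c *\<^sub>C \<sigma> q x" for c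
      unfolding g(2) \<sigma>_coset[OF g(1) x] \<sigma>_coset[OF g(1) closed_csubspaceD(4)[OF csubspace_K x]]
      by (rule rep_scaleC[OF C_carrier[OF g(1)] KH[OF x]])
    fix y assume y: "y \<in> K"
    show "\<sigma> q (x + y) = \<sigma> q x + \<sigma> q y"
      unfolding g(2) \<sigma>_coset[OF g(1) x] \<sigma>_coset[OF g(1) y]
        \<sigma>_coset[OF g(1) closed_csubspaceD(3)[OF csubspace_K x y]]
      by (rule rep_add[OF C_carrier[OF g(1)] KH[OF x] KH[OF y]])
    show "cinner (\<sigma> q x) (\<sigma> q y) = cinner x y"
      unfolding g(2) \<sigma>_coset[OF g(1) x] \<sigma>_coset[OF g(1) y]
      by (rule rep_cinner[OF C_carrier[OF g(1)] KH[OF x] KH[OF y]])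
  next
    fix x assume x: "x \<in> K"
    show "\<sigma> \<one>\<^bsub>?Q\<^esub> x = x" unfolding Mod_one \<sigma>_coset[OF C1 x] by (rule rep_one[OF KH[OF x]])
    show "continuous_map (discrete_topology ((\<lambda>g. V #> g) ` C)) euclidean (\<lambda>q. \<sigma> q x)" by simp
  next
    fix p q x assume "p \<in> (\<lambda>g. V #> g) ` C" "q \<in> (\<lambda>g. V #> g) ` C" and x: "x \<in> K"
    then obtain g h where g: "g \<in> C" "p = V #> g" and h: "h \<in> C" "q = V #> h" by blast
    show "\<sigma> (p \<otimes>\<^bsub>?Q\<^esub> q) x = \<sigma> p (\<sigma> q x)"
      unfolding g(2) h(2) Mod_mult[OF g(1) h(1)] \<sigma>_coset[OF h(1) x]
        \<sigma>_coset[OF subgroup.m_closed[OF subgroup_C g(1) h(1)] x] \<sigma>_coset[OF g(1) rep_K[OF h(1) x]]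
      by (rule rep_mult[OF C_carrier[OF g(1)] C_carrier[OF h(1)] KH[OF x]])
  qed
  moreover have "K \<noteq> {0}" using vector_in_K vector(2) by blast
  moreover have "M = {0} \<or> M = K"
    if M: "closed_csubspace M" "M \<subseteq> K" and inv: "\<forall>q\<in>carrier ?Q. \<sigma> q ` M \<subseteq> M" for M
  proof (rule irreducible_K[OF M])
    fix h x assume h: "h \<in> C" and x: "x \<in> M"
    then have "\<sigma> (V #> h) x \<in> M" using inv unfolding carrier_Mod by blast
    then show "\<pi> h x \<in> M" using \<sigma>_coset[OF h subsetD[OF M(2) x]] by simp
  qed
  ultimately show ?thesis unfolding irreducible_unitary_rep_def by blast
qed


subsection \<open>The unitary equivalence\<close>

text \<open>
  The projection of \<open>x\<close> onto \<open>g K\<close>, translated back to \<open>K\<close>. As a function of \<open>g\<close> it is the element of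
  the induced space that corresponds to \<open>x\<close>.
\<close>

definition component :: "'a \<Rightarrow> 'c \<Rightarrow> 'c"
  where "component g x = proj K (\<pi> (inv g) x)"

lemma component_in_K: "component g x \<in> K"
  unfolding component_def by (rule proj_in[OF csubspace_K])

lemma component_mult:
  assumes g: "g \<in> carrier G" and h: "h \<in> C" and x: "x \<in> H"
  shows "component (g \<otimes> h) x = \<pi> (inv h) (component g x)"
proof -
  have hG: "h \<in> carrier G" and ih: "inv h \<in> C"
    using C_carrier[OF h] subgroup.m_inv_closed[OF subgroup_C h] by blast+
  have "\<pi> (inv (g \<otimes> h)) x = \<pi> (inv h) (\<pi> (inv g) x)"
    using g hG x by (simp add: inv_mult_group rep_mult)
  then show ?thesis
    unfolding component_def using g hG x ih h
    by (simp add: proj_rep[OF csubspace_K K_subset] rep_closed rep_K)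
qed

lemma cinner_translate:
  assumes g: "g \<in> carrier G" and x: "x \<in> H" and k: "k \<in> K"
  shows "cinner x (\<pi> g k) = cinner (component g x) k"
proof -
  have kH: "k \<in> H" using k K_subset by blast
  have "cinner x (\<pi> g k) = cinner (\<pi> (inv g) x) k"
    using cinner_rep_left[of "inv g" x k] g x kH by simp
  moreover have "cinner (\<pi> (inv g) x - component g x) k = 0"
    unfolding component_def by (rule proj_orthogonal[OF csubspace_K k])
  ultimately show ?thesis by (simp add: cinner_diff_left)
qed

lemma component_unique:
  assumes g: "g \<in> carrier G" and x: "x \<in> H" and k: "k \<in> K"
    and eq: "\<And>k'. k' \<in> K \<Longrightarrow> cinner x (\<pi> g k') = cinner k k'"
  shows "component g x = k"
  unfolding component_def
proof (rule proj_unique[OF csubspace_K k])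
  fix y assume y: "y \<in> K"
  have "cinner (\<pi> (inv g) x) y = cinner x (\<pi> g y)"
    using cinner_rep_left[of "inv g" x y] g x y K_subset by auto
  then show "cinner (\<pi> (inv g) x - k) y = 0" using eq[OF y] by (simp add: cinner_diff_left)
qed

context
  fixes R assumes R: "left_transversal G C R"
begin

lemma R_carrier: "t \<in> R \<Longrightarrow> t \<in> carrier G"
  using R unfolding left_transversal_def by blast

lemma R_decompose:
  assumes "g \<in> carrier G"
  obtains t c where "t \<in> R" "c \<in> C" "g = t \<otimes> c"
  using R assms unfolding left_transversal_def l_coset_def by blast

lemma translates_orthogonal_R:
  assumes t: "t \<in> R" and s: "s \<in> R" and neq: "t \<noteq> s" and k: "k \<in> K" and k': "k' \<in> K"
  shows "cinner (\<pi> t k) (\<pi> s k') = 0"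
proof -
  have G: "t \<in> carrier G" "s \<in> carrier G" using t s R_carrier by blast+
  have "inv s \<otimes> t \<notin> C"
  proof
    assume "inv s \<otimes> t \<in> C"
    moreover have "t = s \<otimes> (inv s \<otimes> t)" using G by (simp add: m_assoc[symmetric])
    ultimately have "t \<in> s <# C" unfolding l_coset_def by blast
    moreover have "t \<in> t <# C"
      unfolding l_coset_def using subgroup.one_closed[OF subgroup_C] r_one[OF G(1)] by force
    ultimately show False using R G(1) t s neq unfolding left_transversal_def by blast
  qed
  then have "cinner (\<pi> (inv s \<otimes> t) k) k' = 0" using G by (intro translates_orthogonal k k') auto
  moreover have "cinner (\<pi> (inv s \<otimes> t) k) k' = cinner (\<pi> t k) (\<pi> s k')"
    using G k k' K_subset cinner_rep_left[of "inv s" "\<pi> t k" k'] by (simp add: rep_mult rep_closed subset_iff)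
  ultimately show ?thesis by simp
qed

text \<open>
  The subspaces \<open>t K\<close> with \<open>t \<in> R\<close> cover the orbit of \<open>\<eta>\<close>, because every \<open>g\<close> is some \<open>t c\<close> with \<open>c \<in> C\<close>.
\<close>

lemma zero_if_components_zero:
  assumes x: "x \<in> H" and zero: "\<And>t. t \<in> R \<Longrightarrow> component t x = 0"
  shows "x = 0"
proof (rule orb_total[OF vector x])
  fix g assume "g \<in> carrier G"
  then obtain t c where tc: "t \<in> R" "c \<in> C" "g = t \<otimes> c" by (rule R_decompose)
  have "\<pi> g \<eta> = \<pi> t (\<pi> c \<eta>)"
    unfolding tc(3) by (rule rep_mult[OF R_carrier[OF tc(1)] C_carrier[OF tc(2)] vector(1)])
  then show "cinner x (\<pi> g \<eta>) = 0"
    using cinner_translate[OF R_carrier[OF tc(1)] x rep_K[OF tc(2) vector_in_K]] zero[OF tc(1)] by simp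
qed

lemma component_diff: "g \<in> carrier G \<Longrightarrow> x \<in> H \<Longrightarrow> y \<in> H \<Longrightarrow> component g (x - y) = component g x - component g y"
proof -
  assume g: "g \<in> carrier G" and x: "x \<in> H" and y: "y \<in> H"
  show ?thesis
  proof (rule component_unique[OF g H_closed(5)[OF x y]])
    show "component g x - component g y \<in> K"
      by (intro closed_csubspaceD(5)[OF csubspace_K] component_in_K)
    show "cinner (x - y) (\<pi> g k') = cinner (component g x - component g y) k'" if "k' \<in> K" for k'
      using cinner_translate[OF g x that] cinner_translate[OF g y that] by (simp add: cinner_diff_left)
  qed
qed

lemma eq_if_components_eq:
  assumes x: "x \<in> H" and y: "y \<in> H" and eq: "\<And>t. t \<in> R \<Longrightarrow> component t x = component t y"
  shows "x = y"
proof -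
  have "x - y = 0"
    by (rule zero_if_components_zero[OF H_closed(5)[OF x y]])
      (simp add: component_diff[OF R_carrier x y] eq)
  then show ?thesis by simp
qed

text \<open>
  The vector is the orthogonal sum of the translates \<open>t (f t)\<close>.
\<close>

lemma ex_vector_with_components:
  assumes f: "\<And>t. t \<in> R \<Longrightarrow> f t \<in> K" and summable: "(\<lambda>t. (norm (f t))\<^sup>2) summable_on R"
  shows "\<exists>y\<in>H. (\<forall>t\<in>R. component t y = f t) \<and> (norm y)\<^sup>2 = (\<Sum>\<^sub>\<infinity>t\<in>R. (norm (f t))\<^sup>2)"
proof -
  have fH: "f t \<in> H" if "t \<in> R" for t using f[OF that] K_subset by blast
  have norm_f: "norm (\<pi> t (f t)) = norm (f t)" if "t \<in> R" for t by (rule norm_rep[OF R_carrier[OF that] fH[OF that]])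
  have "pairwise (\<lambda>s t. orthogonal (\<pi> s (f s)) (\<pi> t (f t))) R"
    unfolding pairwise_def orthogonal_def Re_cinner[symmetric]
    using translates_orthogonal_R f by simp
  moreover have "(\<lambda>t. (norm (\<pi> t (f t)))\<^sup>2) summable_on R"
    using summable by (rule summable_on_cong[THEN iffD1, rotated]) (simp add: norm_f)
  ultimately obtain y where y: "((\<lambda>t. \<pi> t (f t)) has_sum y) R"
    and ny: "(norm y)\<^sup>2 = (\<Sum>\<^sub>\<infinity>t\<in>R. (norm (\<pi> t (f t)))\<^sup>2)"
    using orthogonal_has_sum[of "\<lambda>t. \<pi> t (f t)" R] by blast
  have lim: "(sum (\<lambda>t. \<pi> t (f t)) \<longlongrightarrow> y) (finite_subsets_at_top R)" using y unfolding has_sum_def .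
  have "sum (\<lambda>t. \<pi> t (f t)) F \<in> H" if "F \<subseteq> R" for F
    using that rep_closed[OF R_carrier fH]
    by (intro subspace_sum closed_csubspace_imp_subspace csubspace) auto
  then have "\<forall>\<^sub>F F in finite_subsets_at_top R. sum (\<lambda>t. \<pi> t (f t)) F \<in> H"
    by (intro eventually_finite_subsets_at_top_weakI)
  from Lim_in_closed_set[OF H_closed(1) this _ lim] have yH: "y \<in> H" by simp
  have "component s y = f s" if s: "s \<in> R" for s
  proof (rule component_unique[OF R_carrier[OF s] yH f[OF s]])
    fix k assume k: "k \<in> K"
    have "cinner (sum (\<lambda>t. \<pi> t (f t)) F) (\<pi> s k) = cinner (f s) k"
      if F: "finite F" "{s} \<subseteq> F" "F \<subseteq> R" for F
    proof -
      have zero: "cinner (sum (\<lambda>t. \<pi> t (f t)) E) (\<pi> s k) = 0" if "finite E" "E \<subseteq> R - {s}" for E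
        using that
      proof (induction E rule: finite_induct)
        case (insert t E)
        then have "cinner (\<pi> t (f t)) (\<pi> s k) = 0" using s k f by (intro translates_orthogonal_R) auto
        then show ?case using insert by (simp add: cinner_add_left)
      qed simp
      have "sum (\<lambda>t. \<pi> t (f t)) F = \<pi> s (f s) + sum (\<lambda>t. \<pi> t (f t)) (F - {s})"
        using F by (intro sum.remove) auto
      then have "cinner (sum (\<lambda>t. \<pi> t (f t)) F) (\<pi> s k) = cinner (\<pi> s (f s)) (\<pi> s k)"
        using zero[of "F - {s}"] F by (simp add: cinner_add_left Diff_mono)
      also have "\<dots> = cinner (f s) k" using k K_subset by (intro rep_cinner R_carrier s fH) auto
      finally show ?thesis .
    qed
    then have "\<forall>\<^sub>F F in finite_subsets_at_top R. cinner (sum (\<lambda>t. \<pi> t (f t)) F) (\<pi> s k) = cinner (f s) k"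
      unfolding eventually_finite_subsets_at_top using s by (intro exI[of _ "{s}"]) simp
    then have "((\<lambda>F. cinner (sum (\<lambda>t. \<pi> t (f t)) F) (\<pi> s k)) \<longlongrightarrow> cinner (f s) k) (finite_subsets_at_top R)"
      by (rule tendsto_eventually)
    moreover have "((\<lambda>F. cinner (sum (\<lambda>t. \<pi> t (f t)) F) (\<pi> s k)) \<longlongrightarrow> cinner y (\<pi> s k)) (finite_subsets_at_top R)"
      by (rule tendsto_cinner_left[OF lim])
    ultimately show "cinner y (\<pi> s k) = cinner (f s) k"
      using tendsto_unique finite_subsets_at_top_neq_bot by blast
  qed
  moreover have "(norm y)\<^sup>2 = (\<Sum>\<^sub>\<infinity>t\<in>R. (norm (f t))\<^sup>2)"
    unfolding ny by (rule infsum_cong) (simp add: norm_f)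
  ultimately show ?thesis using yH by blast
qed

lemma summable_components:
  assumes x: "x \<in> H"
  shows "(\<lambda>t. (norm (component t x))\<^sup>2) summable_on R"
proof (rule nonneg_bdd_above_summable_on)
  show "bdd_above (sum (\<lambda>t. (norm (component t x))\<^sup>2) ` {F. F \<subseteq> R \<and> finite F})"
  proof (rule bdd_aboveI2)
    fix F assume "F \<in> {F. F \<subseteq> R \<and> finite F}"
    then have F: "F \<subseteq> R" "finite F" by auto
    define p where "p t = \<pi> t (component t x)" for t
    have cH: "component t x \<in> H" for t using component_in_K K_subset by blast
    have norm_p: "norm (p t) = norm (component t x)" if "t \<in> F" for t
      unfolding p_def using that F by (intro norm_rep cH R_carrier) auto
    have "(\<Sum>t\<in>F. (norm (p t))\<^sup>2) \<le> (norm x)\<^sup>2"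
    proof (rule bessel_finite[OF F(2)])
      show "pairwise (\<lambda>i j. orthogonal (p i) (p j)) F"
        unfolding pairwise_def orthogonal_def Re_cinner[symmetric] p_def
        using translates_orthogonal_R component_in_K F(1) by (simp add: subset_iff)
      fix t assume t: "t \<in> F"
      have "cinner x (p t) = cinner (component t x) (component t x)"
        unfolding p_def using t F by (intro cinner_translate x component_in_K R_carrier) auto
      then show "x \<bullet> p t = (norm (p t))\<^sup>2"
        unfolding norm_p[OF t] Re_cinner[symmetric] by (simp add: cinner_self)
    qed
    then show "(\<Sum>t\<in>F. (norm (component t x))\<^sup>2) \<le> (norm x)\<^sup>2" by (simp add: norm_p)
  qed
qed simp

text \<open>
  Surjectivity and the preservation of norms both come from \<open>ex_vector_with_components\<close>, the latter
  because the vector built from the components of \<open>x\<close> is \<open>x\<close> itself.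
\<close>

lemma equivalent_to_induced_K: "equivalent_to_induced G H \<pi> C K (\<lambda>h. \<sigma> (V #> h)) R"
proof -
  define U where "U x = (\<lambda>g\<in>carrier G. component g x)" for x
  let ?I = "induced_space G C K (\<lambda>h. \<sigma> (V #> h)) R"
  have UR: "U x t = component t x" if "t \<in> R" for x t using R_carrier[OF that] by (simp add: U_def)
  have sum_U: "(\<lambda>t. (norm (U x t))\<^sup>2) summable_on R" if "x \<in> H" for x
    using summable_components[OF that] by (rule summable_on_cong[THEN iffD1, rotated]) (simp add: UR)
  have \<sigma>_inv: "\<sigma> (V #> inv h) k = \<pi> (inv h) k" if "h \<in> C" "k \<in> K" for h k
    by (rule \<sigma>_coset[OF subgroup.m_inv_closed[OF subgroup_C that(1)] that(2)])
  have "inj_on U H"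
  proof (rule inj_onI)
    fix x y assume x: "x \<in> H" and y: "y \<in> H" and eq: "U x = U y"
    have "component t x = component t y" if "t \<in> R" for t using UR[OF that] eq by metis
    then show "x = y" by (rule eq_if_components_eq[OF x y])
  qed
  moreover have "U ` H = ?I"
  proof (intro equalityI subsetI)
    fix f assume "f \<in> U ` H"
    then obtain x where x: "x \<in> H" "f = U x" by blast
    have "U x (g \<otimes> h) = \<sigma> (V #> inv h) (U x g)" if "g \<in> carrier G" "h \<in> C" for g h
      using component_mult[OF that x(1)] \<sigma>_inv[OF that(2) component_in_K] that C_carrier[OF that(2)]
      by (simp add: U_def)
    moreover have "U x \<in> carrier G \<rightarrow>\<^sub>E K" unfolding U_def using component_in_K by simp
    ultimately show "f \<in> ?I" unfolding x(2) induced_space_def using sum_U[OF x(1)] by simp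
  next
    fix f assume f: "f \<in> ?I"
    then have fPi: "f \<in> carrier G \<rightarrow>\<^sub>E K"
      and equi: "\<And>g h. g \<in> carrier G \<Longrightarrow> h \<in> C \<Longrightarrow> f (g \<otimes> h) = \<sigma> (V #> inv h) (f g)"
      and summable: "(\<lambda>t. (norm (f t))\<^sup>2) summable_on R"
      unfolding induced_space_def by auto
    have fK: "f g \<in> K" if "g \<in> carrier G" for g using fPi that by (rule PiE_mem)
    obtain y where y: "y \<in> H" "\<And>t. t \<in> R \<Longrightarrow> component t y = f t"
      using ex_vector_with_components[OF fK[OF R_carrier] summable] by blast
    have "component g y = f g" if g: "g \<in> carrier G" for g
    proof -
      obtain t c where tc: "t \<in> R" "c \<in> C" "g = t \<otimes> c" using g by (rule R_decompose)
      have tG: "t \<in> carrier G" by (rule R_carrier[OF tc(1)])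
      show ?thesis
        unfolding tc(3) component_mult[OF tG tc(2) y(1)] y(2)[OF tc(1)] equi[OF tG tc(2)] \<sigma>_inv[OF tc(2) fK[OF tG]] ..
    qed
    then have "U y = f" unfolding U_def using fPi by (intro ext) (auto simp: PiE_def extensional_def)
    then show "f \<in> U ` H" using y(1) by blast
  qed
  ultimately have "bij_betw U H ?I" unfolding bij_betw_def by blast
  moreover have "U (x + y) = (\<lambda>g\<in>carrier G. U x g + U y g)" if "x \<in> H" "y \<in> H" for x y
    unfolding U_def using that
    by (intro restrict_ext) (simp add: component_def rep_add proj_add[OF csubspace_K])
  moreover have "U (c *\<^sub>C x) = (\<lambda>g\<in>carrier G. c *\<^sub>C U x g)" if "x \<in> H" for c x
    unfolding U_def using that
    by (intro restrict_ext) (simp add: component_def rep_scaleC proj_scaleC[OF csubspace_K])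
  moreover have "induced_norm R (U x) = norm x" if x: "x \<in> H" for x
  proof -
    obtain y where y: "y \<in> H" "\<And>t. t \<in> R \<Longrightarrow> component t y = U x t"
      "(norm y)\<^sup>2 = (\<Sum>\<^sub>\<infinity>t\<in>R. (norm (U x t))\<^sup>2)"
      using ex_vector_with_components[of "U x", OF _ sum_U[OF x]] UR component_in_K by metis
    have "y = x" by (rule eq_if_components_eq[OF y(1) x]) (simp add: y(2) UR)
    then show ?thesis unfolding induced_norm_def using y(3) by (metis norm_ge_zero real_sqrt_unique)
  qed
  moreover have "U (\<pi> g x) = induced_action G g (U x)" if g: "g \<in> carrier G" and x: "x \<in> H" for g x
    unfolding U_def induced_action_def
  proof (rule restrict_ext)
    fix h assume h: "h \<in> carrier G"
    have "\<pi> (inv h) (\<pi> g x) = \<pi> (inv (inv g \<otimes> h)) x" using g h x by (simp add: inv_mult_group rep_mult)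
    then show "component h (\<pi> g x) = (\<lambda>g\<in>carrier G. component g x) (inv g \<otimes> h)"
      using g h by (simp add: component_def)
  qed
  ultimately show ?thesis unfolding equivalent_to_induced_def by blast
qed

end

end


section \<open>The classification theorem\<close>

theorem theorem1p3:
  fixes G :: "('g, 'z) monoid_scheme" and T :: "'g topology"
  assumes "oligomorphic_group G T"
  shows "(\<forall>(H :: 'h::complex_hilbert_space set) \<pi>. irreducible_unitary_rep G T H \<pi> \<longrightarrow>
           (\<exists>V (K :: 'h set) \<sigma>.
              subgroup V G \<and> openin T V \<and>
              V \<lhd> G\<lparr>carrier := commensurator G V\<rparr> \<and>
              finite (carrier (G\<lparr>carrier := commensurator G V\<rparr> Mod V)) \<and>
              irreducible_unitary_rep (G\<lparr>carrier := commensurator G V\<rparr> Mod V)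
                (discrete_topology (carrier (G\<lparr>carrier := commensurator G V\<rparr> Mod V))) K \<sigma> \<and>
              (\<forall>R. left_transversal G (commensurator G V) R \<longrightarrow>
                 equivalent_to_induced G H \<pi> (commensurator G V) K (\<lambda>h. \<sigma> (V #>\<^bsub>G\<^esub> h)) R)))
       \<and> (\<forall>(H :: 'h set) \<pi>. unitary_rep G T H \<pi> \<longrightarrow> direct_sum_of_irreducibles G T H \<pi>)"
proof (intro conjI allI impI)
  interpret G: roelcke_precompact_group G T by (rule oligomorphic_imp_roelcke_precompact[OF assms])
  fix H :: "'h set" and \<pi>
  show "direct_sum_of_irreducibles G T H \<pi>" if "unitary_rep G T H \<pi>"
  proof -
    interpret unitary_representation G T H \<pi> by unfold_locales (rule that)
    show ?thesis by (rule direct_sum)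
  qed
  assume irr: "irreducible_unitary_rep G T H \<pi>"
  interpret unitary_representation G T H \<pi>
    by unfold_locales (use irr in \<open>simp add: irreducible_unitary_rep_def\<close>)
  have "H \<noteq> {0}" using irr by (simp add: irreducible_unitary_rep_def)
  then obtain \<eta> where "\<eta> \<in> H" "\<eta> \<noteq> 0" "finite (coefficients \<eta>)"
      "\<forall>x\<in>orb \<eta>. x \<notin> acl \<eta> \<longrightarrow> cinner x \<eta> = 0"
    using ex_minimal_vector by blast
  then interpret irreducible_minimal_vector G T H \<pi> \<eta>
    by unfold_locales (use irr in auto)
  show "\<exists>V (K :: 'h set) \<sigma>.
      subgroup V G \<and> openin T V \<and>
      V \<lhd> G\<lparr>carrier := commensurator G V\<rparr> \<and>
      finite (carrier (G\<lparr>carrier := commensurator G V\<rparr> Mod V)) \<and>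
      irreducible_unitary_rep (G\<lparr>carrier := commensurator G V\<rparr> Mod V)
        (discrete_topology (carrier (G\<lparr>carrier := commensurator G V\<rparr> Mod V))) K \<sigma> \<and>
      (\<forall>R. left_transversal G (commensurator G V) R \<longrightarrow>
         equivalent_to_induced G H \<pi> (commensurator G V) K (\<lambda>h. \<sigma> (V #>\<^bsub>G\<^esub> h)) R)"
  proof (intro exI conjI allI impI)
    show "subgroup V G" by (rule subgroup_V)
    show "openin T V" by (rule openin_V)
    show "V \<lhd> G\<lparr>carrier := commensurator G V\<rparr>" unfolding commensurator_V by (rule normal_V)
    show "finite (carrier (G\<lparr>carrier := commensurator G V\<rparr> Mod V))"
      unfolding commensurator_V FactGroup_def using finite_rcosets_V by simp
    show "irreducible_unitary_rep (G\<lparr>carrier := commensurator G V\<rparr> Mod V)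
        (discrete_topology (carrier (G\<lparr>carrier := commensurator G V\<rparr> Mod V))) K \<sigma>"
      unfolding commensurator_V by (rule irreducible_\<sigma>)
    show "equivalent_to_induced G H \<pi> (commensurator G V) K (\<lambda>h. \<sigma> (V #>\<^bsub>G\<^esub> h)) R"
      if "left_transversal G (commensurator G V) R" for R
      using that unfolding commensurator_V by (rule equivalent_to_induced_K)
  qed
qed

end
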